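(* Spherical arc-length is a global conformal parameter for any analytic curve in $\mathbb{C}\cup\{\infty\}$.
   Context: Here $\mathbb{C}\cup\{\infty\}$ is the Riemann sphere, and in $\mathbb{R}\cup\{\infty\}$ the points $+\infty$, $\infty$ and $-\infty$ are identified. Definition (analytic curve in the Riemann sphere). A curve $\gamma$ in $\mathbb{C}\cup\{\infty\}$ is said to be analytic with respect to a parametrization with parameter $t$ if for every value $t_0\in\mathbb{R}\cup\{\infty\}$ in the range of the parameter $t$ there exist an open set $\Delta$ in the space where the parameter varies (which may be an interval, the union of two intervals with the point $\infty$ common to them, etc.) containing $t_0$, an open set $V$ in $\mathbb{C}\cup\{\infty\}$ such that $t_0\in\Delta\subset V$, and an injective meromorphic function $\phi:V\to\mathbb{C}\cup\{\infty\}$ such that $\phi|_\Delta=\gamma|_\Delta$. Spherical arc-length. The derivative of spherical arc-length with respect to the parameter $t$ of a curve $\gamma$ is $\frac{|\gamma'(t)|}{1+|\gamma(t)|^2}$. The map $z\mapsto 1/z$ is an isometry for spherical arc-length, so $\gamma$ and $1/\gamma$ have the same spherical arc-length parameter; this is used where $\gamma$ takes the value $\infty$. Near the parameter value $t=\infty$ the spherical length of $\gamma$ is computed with the parameter $1/t$ near $0$. The spherical arc-length parameter is taken to be strictly increasing along the curve and is allowed to take negative values. That an arc-length is a "global conformal parameter" for an analytic curve means that the curve remains analytic when it is parametrized by that arc-length. "Conformal" means locally conformal, i.e. holomorphic and locally injective. *)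

theory Defs
  imports "HOL-Analysis.Analysis" "HOL-Complex_Analysis.Complex_Analysis"
begin

text \<open>
  The spaces \<open>\<complex> \<union> {\<infinity>}\<close> and \<open>\<real> \<union> {\<infinity>}\<close> are modelled by the types \<open>complex option\<close> and
  \<open>real option\<close>, with \<open>None\<close> for the point \<open>\<infinity>\<close>, and are topologised as one-point
  compactifications. In particular \<open>+\<infinity>\<close> and \<open>-\<infinity>\<close> are the same point of \<open>\<real> \<union> {\<infinity>}\<close>.
\<close>

abbreviation sphere_top :: "complex option topology" where
  "sphere_top \<equiv> Alexandroff_compactification euclidean"

abbreviation circle_top :: "real option topology" where
  "circle_top \<equiv> Alexandroff_compactification euclidean"

abbreviation real_to_sphere :: "real option \<Rightarrow> complex option" where
  "real_to_sphere \<equiv> map_option complex_of_real"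

text \<open>The map \<open>z \<mapsto> 1/z\<close>, exchanging \<open>0\<close> and \<open>\<infinity>\<close>.\<close>

definition recip :: "'a::field option \<Rightarrow> 'a option" where
  "recip p = (case p of None \<Rightarrow> Some 0 | Some z \<Rightarrow> if z = 0 then None else Some (1 / z))"

text \<open>
  The library's meromorphic functions are total functions of type \<open>complex \<Rightarrow> complex\<close>, with
  \<open>f nicely_meromorphic_on A\<close> normalising the value at a pole to be \<open>0\<close>. A map into the sphere
  is meromorphic on \<open>A \<subseteq> \<complex>\<close> if it takes the value \<open>\<infinity>\<close> exactly at the poles of such a function
  and agrees with that function elsewhere; in particular, it is not constantly \<open>\<infinity>\<close> near any
  point.
\<close>

definition fin_val :: "(complex \<Rightarrow> complex option) \<Rightarrow> complex \<Rightarrow> complex" where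
  "fin_val g z = (case g z of None \<Rightarrow> 0 | Some w \<Rightarrow> w)"

definition plane_meromorphic_on :: "(complex \<Rightarrow> complex option) \<Rightarrow> complex set \<Rightarrow> bool" where
  "plane_meromorphic_on g A \<longleftrightarrow>
     fin_val g nicely_meromorphic_on A \<and> (\<forall>z\<in>A. g z = None \<longleftrightarrow> is_pole (fin_val g) z)"

text \<open>The two conjuncts are the two charts \<open>z\<close> and \<open>1/z\<close> of the source.\<close>

definition sphere_meromorphic_on ::
    "(complex option \<Rightarrow> complex option) \<Rightarrow> complex option set \<Rightarrow> bool" where
  "sphere_meromorphic_on \<phi> V \<longleftrightarrow>
     plane_meromorphic_on (\<lambda>z. \<phi> (Some z)) {z. Some z \<in> V} \<and>
     plane_meromorphic_on (\<lambda>z. \<phi> (recip (Some z))) {z. recip (Some z) \<in> V}"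

text \<open>
  The spaces in which a parameter may vary: non-degenerate arcs of \<open>\<real> \<union> {\<infinity>}\<close> (with or without
  endpoints, possibly passing through \<open>\<infinity>\<close>), or all of \<open>\<real> \<union> {\<infinity>}\<close>.
\<close>

definition parameter_space :: "real option set \<Rightarrow> bool" where
  "parameter_space I \<longleftrightarrow> connectedin circle_top I \<and> (\<exists>a\<in>I. \<exists>b\<in>I. a \<noteq> b)"

text \<open>Analyticity with respect to the given parametrization of the curve \<open>\<gamma>\<close> on \<open>I\<close>.\<close>

definition analytic_curve :: "real option set \<Rightarrow> (real option \<Rightarrow> complex option) \<Rightarrow> bool" where
  "analytic_curve I \<gamma> \<longleftrightarrow>
     (\<forall>t0\<in>I. \<exists>\<Delta> V \<phi>.
        openin (subtopology circle_top I) \<Delta> \<and> t0 \<in> \<Delta> \<and>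
        openin sphere_top V \<and> real_to_sphere ` \<Delta> \<subseteq> V \<and>
        sphere_meromorphic_on \<phi> V \<and> inj_on \<phi> V \<and>
        (\<forall>t\<in>\<Delta>. \<phi> (real_to_sphere t) = \<gamma> t))"

text \<open>
  The derivative \<open>|g'(u)| / (1 + |g(u)|\<^sup>2)\<close> of spherical arc-length, computed from \<open>1/g\<close> at
  points where \<open>g\<close> takes the value \<open>\<infinity>\<close>. (The value of \<open>the None\<close> is irrelevant, since a
  continuous \<open>g\<close> with \<open>g u \<noteq> \<infinity>\<close> is finite near \<open>u\<close>.)
\<close>

definition finite_speed :: "(real \<Rightarrow> complex option) \<Rightarrow> real set \<Rightarrow> real \<Rightarrow> real" where
  "finite_speed g S u =
     norm (vector_derivative (\<lambda>v. the (g v)) (at u within S)) / (1 + (norm (the (g u)))\<^sup>2)"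

definition spherical_speed :: "(real \<Rightarrow> complex option) \<Rightarrow> real set \<Rightarrow> real \<Rightarrow> real" where
  "spherical_speed g S u =
     (if g u = None then finite_speed (\<lambda>v. recip (g v)) S u else finite_speed g S u)"

text \<open>
  \<open>\<sigma>\<close> is a spherical arc-length of the curve \<open>\<gamma>\<close> along the part \<open>A\<close> of its parameter space. At
  \<open>t = \<infinity>\<close> the derivative is taken with respect to \<open>u = 1/t\<close> at \<open>u = 0\<close>; the sign there is
  negative because \<open>u\<close> decreases when \<open>t\<close> increases (through \<open>+\<infinity> = -\<infinity>\<close>), whereas \<open>\<sigma>\<close> has to
  increase along the curve. The additive constant in \<open>\<sigma>\<close> is arbitrary.
\<close>

definition spherical_arclength ::
    "real option set \<Rightarrow> (real option \<Rightarrow> complex option) \<Rightarrow> (real option \<Rightarrow> real) \<Rightarrow> bool" where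
  "spherical_arclength A \<gamma> \<sigma> \<longleftrightarrow>
     (\<forall>t. Some t \<in> A \<longrightarrow>
        ((\<lambda>u. \<sigma> (Some u)) has_real_derivative
           spherical_speed (\<lambda>u. \<gamma> (Some u)) {u. Some u \<in> A} t) (at t within {u. Some u \<in> A})) \<and>
     (None \<in> A \<longrightarrow>
        ((\<lambda>u. \<sigma> (recip (Some u))) has_real_derivative
           - spherical_speed (\<lambda>u. \<gamma> (recip (Some u))) {u. recip (Some u) \<in> A} 0)
          (at 0 within {u. recip (Some u) \<in> A}))"

text \<open>
  \<open>h\<close> expresses the original parameter in \<open>I\<close> as a function of the spherical arc-length, which
  ranges over the real interval \<open>J\<close>, so that \<open>\<gamma> \<circ> h\<close> is the curve parametrized by spherical
  arc-length. If \<open>I\<close> is not the whole circle, \<open>h\<close> is a bijection, inverse to a single-valued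
  arc-length on \<open>I\<close>. On the whole circle \<open>\<real> \<union> {\<infinity>}\<close> arc-length is multi-valued; then it ranges
  over all of \<open>\<real>\<close>, and \<open>h\<close> winds around the circle. In both cases \<open>h\<close> is
  locally the inverse of an arc-length.
\<close>

definition arclength_parametrization ::
    "real option set \<Rightarrow> (real option \<Rightarrow> complex option) \<Rightarrow> real set \<Rightarrow> (real \<Rightarrow> real option) \<Rightarrow> bool"
  where
  "arclength_parametrization I \<gamma> J h \<longleftrightarrow>
     is_interval J \<and> continuous_map (top_of_set J) circle_top h \<and> h ` J = I \<and>
     (if I = UNIV then J = UNIV else inj_on h J) \<and>
     (\<forall>s0\<in>J. \<exists>N \<sigma>.
        openin (top_of_set J) N \<and> s0 \<in> N \<and> openin (subtopology circle_top I) (h ` N) \<and>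
        spherical_arclength (h ` N) \<gamma> \<sigma> \<and> (\<forall>s\<in>N. \<sigma> (h s) = s))"

end

(*
  The tangent covers the circle R + {oo} by the real line, with None over the zeros of the cosine,
  so a curve on I pulls back to a curve g on an interval of reals. Locally g = f or g = 1/f with f
  holomorphic and injective, and as inversion is an isometry its spherical speed is
  |f'| / (1 + |f|^2) in both cases. On the real axis |f|^2 is f(z) times the conjugate of
  f(conj z), and likewise for f', so the speed is the restriction of a holomorphic function with a
  primitive P that is locally injective. There arc-length coincides with P, hence the curve
  parametrized by arc-length is f o P^{-1} or its reciprocal.

  An arc-length parametrization is the covering composed with the inverse of a primitive of the
  speed. If I is the whole circle, the speed has period pi and so a positive lower bound, and the
  primitive maps onto R.
*)

theory Submission
  imports Defs
begin

subsection \<open>Charts of the compactifications\<close>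

text \<open>The angle variable removes two difficulties at once: infinity becomes an ordinary value
  of the parameter, and arc-length, multi-valued on the whole circle, becomes single-valued on the
  line. It also treats both parameter charts alike, since tan' = 1 + tan^2 and cot' = -(1 + cot^2):
  the factors agree up to the sign that the definition of arc-length carries at infinity. An
  arc-length is given only as a differentiable function and a parametrization by it only as a
  continuous one. Smoothness of the parametrization is therefore never proved by itself; it is read
  off from the holomorphic primitive, once this is known to agree with the arc-length on an
  interval. Injectivity of the local forms enters as nonvanishing of f': it makes the speed
  positive, keeps |f'|^2 off the cut of the square root and makes the primitive locally invertible.
  Endpoints of the parameter space are allowed, so derivatives are taken within sets, and
  limit-point conditions keep them unique.\<close>

definition chart :: "bool \<Rightarrow> 'a::field \<Rightarrow> 'a option" where
  "chart c w = (if c then recip (Some w) else Some w)"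

lemma chart_False [simp]: "chart False = Some"
  by (auto simp: chart_def fun_eq_iff)

lemma recip_recip [simp]: "recip (recip p) = p"
  by (auto simp: recip_def split: option.splits)

lemma recip_chart [simp]: "recip (chart c w) = chart (\<not> c) w"
  by (auto simp: chart_def)

lemma chart_eq_iff [simp]: "chart c v = chart c w \<longleftrightarrow> v = w"
  by (metis chart_def option.inject recip_recip)

lemma real_to_sphere_chart [simp]: "real_to_sphere (chart c u) = chart c (of_real u)"
  by (auto simp: chart_def recip_def)

lemma chart_True_nonzero: "w \<noteq> 0 \<Longrightarrow> chart True w = Some (1 / w)"
  by (auto simp: chart_def recip_def)

lemma chart_True_0 [simp]: "chart True 0 = None"
  by (auto simp: chart_def recip_def)

text \<open>The second chart is used for the point at infinity only, with coordinate 0. This matches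
  \<open>spherical_arclength\<close>, which prescribes a derivative in the chart 1/t at 0
  alone.\<close>

lemma chart_exhaust: obtains c u where "p = chart c u" "c \<Longrightarrow> u = 0"
proof (cases p)
  case None
  then show ?thesis using that[of True 0] by simp
next
  case (Some a)
  then show ?thesis using that[of False a] by simp
qed

text \<open>A compact set is bounded, so its complement, transported by 1/u, contains a punctured
  ball about 0. Conversely, a ball about 0 in the chart at infinity bounds the finite points missing
  from \<open>U\<close>, and the Heine-Borel property makes them compact.\<close>

lemma openin_compactification_iff:
  fixes U :: "'a::{real_normed_field, heine_borel} option set"
  shows "openin (Alexandroff_compactification euclidean) U \<longleftrightarrow> (\<forall>c. open {u. chart c u \<in> U})"
proof
  assume U: "openin (Alexandroff_compactification euclidean) U"
  have cont: "continuous_on (-{0}) (\<lambda>u::'a. 1 / u)"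
    by (intro continuous_intros) auto
  have opn: "open {u::'a. u \<noteq> 0 \<and> 1 / u \<in> W}" if "open W" for W
  proof -
    have "open ((\<lambda>u::'a. 1 / u) -` W \<inter> -{0})"
      using cont that by (subst (asm) continuous_on_open_vimage) auto
    also have "(\<lambda>u::'a. 1 / u) -` W \<inter> -{0} = {u. u \<noteq> 0 \<and> 1 / u \<in> W}" by auto
    finally show ?thesis .
  qed
  from U consider W where "open W" "U = Some ` W"
    | C where "compact C" "U = insert None (Some ` (-C))"
    by (auto simp: openin_Alexandroff_compactification Compl_eq_Diff_UNIV)
  then show "\<forall>c. open {u. chart c u \<in> U}"
  proof cases
    case 1
    have "{u. chart True u \<in> U} = {u. u \<noteq> 0 \<and> 1 / u \<in> W}"
      by (auto simp: 1 chart_def recip_def)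
    moreover have "{u. chart False u \<in> U} = W" using 1 by auto
    ultimately have "open {u. chart c u \<in> U}" for c
      using opn[of W] 1 by (cases c) simp_all
    then show ?thesis by blast
  next
    case 2
    obtain B where B: "B > 0" "\<And>u. u \<in> C \<Longrightarrow> norm u \<le> B"
      using compact_imp_bounded[OF 2(1)] bounded_pos by blast
    have small: "1 / u \<notin> C" if "u \<in> ball 0 (1 / (B + 1))" "u \<noteq> 0" for u
    proof
      assume "1 / u \<in> C"
      then have "1 / norm u \<le> B" using B(2)[of "1 / u"] by (simp add: norm_divide)
      then have "1 \<le> B * norm u" using \<open>u \<noteq> 0\<close> by (simp add: field_simps)
      moreover have "B * norm u + norm u < 1" using that B(1) by (simp add: field_simps)
      ultimately show False using norm_ge_zero[of u] by linarith
    qed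
    have "{u. chart True u \<in> U} = {u. u \<noteq> 0 \<and> 1 / u \<in> -C} \<union> ball 0 (1 / (B + 1))"
      using small B(1) by (auto simp: 2 chart_def recip_def)
    moreover have "{u. chart False u \<in> U} = -C" using 2 by auto
    moreover have "open (-C)" using 2 compact_imp_closed by blast
    ultimately have "open {u. chart c u \<in> U}" for c
      using opn[of "-C"] by (cases c) (simp_all add: open_Un)
    then show ?thesis by blast
  qed
next
  assume open_charts: "\<forall>c. open {u. chart c u \<in> U}"
  have o1: "open {u. Some u \<in> U}" using open_charts[rule_format, of False] by simp
  show "openin (Alexandroff_compactification euclidean) U"
  proof (cases "None \<in> U")
    case False
    then have "p \<in> U \<longleftrightarrow> p \<in> Some ` {u. Some u \<in> U}" for p by (cases p) auto
    then have "U = Some ` {u. Some u \<in> U}" by blast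
    then show ?thesis using o1 by (metis openin_Alexandroff_compactification_image_Some open_openin)
  next
    case True
    define C where "C = {u. Some u \<notin> U}"
    have "closed C" using o1 by (auto simp: C_def closed_def Collect_neg_eq [symmetric])
    have "open {u. chart True u \<in> U}" using open_charts by blast
    then obtain e where e: "e > 0" "ball 0 e \<subseteq> {u. chart True u \<in> U}"
      using True by (metis chart_True_0 mem_Collect_eq openE)
    have "norm u \<le> 1 / e" if "u \<in> C" for u
    proof (rule ccontr)
      assume *: "\<not> norm u \<le> 1 / e"
      then have "u \<noteq> 0" using e by auto
      have "norm (1 / u) < e" using * e \<open>u \<noteq> 0\<close> by (simp add: norm_divide field_simps)
      then have "chart True (1 / u) \<in> U" using e(2) by auto
      then show False using \<open>u \<noteq> 0\<close> that by (auto simp: C_def chart_True_nonzero)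
    qed
    then have "bounded C" using bounded_iff by blast
    then have "compact C" using \<open>closed C\<close> compact_eq_bounded_closed by blast
    moreover have "p \<in> U \<longleftrightarrow> p \<in> insert None (Some ` (-C))" for p
      using True by (cases p) (auto simp: C_def)
    then have "U = insert None (Some ` (-C))" by blast
    ultimately show ?thesis using \<open>closed C\<close>
      by (auto simp: openin_Alexandroff_compactification Compl_eq_Diff_UNIV)
  qed
qed

subsection \<open>The covering of the circle by the tangent\<close>

definition cover :: "real \<Rightarrow> real option" where
  "cover x = (if cos x = 0 then None else Some (tan x))"

text \<open>The denominator of cot or tan, marking where \<open>coord\<close> is a genuine
  coordinate. The type is general because real arguments give the parameter of the curve and complex
  ones extend the change of parameter holomorphically.\<close>

definition coord_den :: "bool \<Rightarrow> 'a::{real_normed_field,banach} \<Rightarrow> 'a" where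
  "coord_den c z = (if c then sin z else cos z)"

definition coord :: "bool \<Rightarrow> 'a::{real_normed_field,banach} \<Rightarrow> 'a" where
  "coord c z = (if c then cot z else tan z)"

text \<open>For the chart at infinity this is the arc cotangent with values in (0, pi), the branch
  that is smooth through \<open>u = 0\<close>.\<close>

definition lift :: "bool \<Rightarrow> real \<Rightarrow> real" where
  "lift c u = (if c then pi / 2 - arctan u else arctan u)"

lemma coord_of_real: "coord c (of_real x) = (of_real (coord c x) :: complex)"
  by (auto simp: coord_def tan_of_real cot_of_real)

lemma coord_den_of_real: "coord_den c (of_real x) = (of_real (coord_den c x) :: complex)"
  by (auto simp: coord_den_def sin_of_real cos_of_real)

lemma cover_eq_chart: "coord_den c x \<noteq> 0 \<Longrightarrow> cover x = chart c (coord c x)"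
  by (cases c) (auto simp: cover_def coord_den_def coord_def chart_def recip_def cot_def tan_def)

lemma cover_eq_chartD:
  assumes "cover x = chart c u"
  shows "coord_den c x \<noteq> 0" "coord c x = u"
proof -
  show "coord_den c x \<noteq> 0"
  proof
    assume 0: "coord_den c x = 0"
    show False
    proof (cases c)
      case True
      then have "cover x = Some 0"
        using 0 sin_zero_abs_cos_one[of x] by (auto simp: cover_def coord_den_def tan_def)
      then show False using assms True by (auto simp: chart_def recip_def split: if_splits)
    next
      case False
      then show False using assms 0 by (simp add: cover_def coord_den_def)
    qed
  qed
  then show "coord c x = u" using assms cover_eq_chart by (metis chart_eq_iff)
qed

lemma coord_lift [simp]: "coord c (lift c u) = u"
  using sum_power2_gt_zero_iff[of 1 u]
  by (auto simp: coord_def lift_def tan_arctan cot_def tan_def sin_diff cos_diff sin_arctan cos_arctan)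

lemma cover_lift [simp]: "cover (lift c u) = chart c u"
proof -
  have "coord_den c (lift c u) \<noteq> 0"
    by (auto simp: coord_den_def lift_def sin_diff)
  then show ?thesis by (simp add: cover_eq_chart)
qed

text \<open>Off the zeros of the cosine, sin (x - y) is the numerator of tan x - tan y; if one
  cosine vanishes, sin (x - y) vanishes exactly when the other one does. So the fibres are given by
  the zeros of a single sine.\<close>

lemma cover_eq_iff: "cover x = cover y \<longleftrightarrow> (\<exists>k::int. x = y + k * pi)"
proof -
  have "cover x = cover y \<longleftrightarrow> sin (x - y) = 0"
  proof (cases "cos x = 0 \<or> cos y = 0")
    case True
    then show ?thesis
      using sin_zero_abs_cos_one[of x] sin_zero_abs_cos_one[of y]
      by (auto simp: cover_def sin_diff)
  next
    case False
    then show ?thesis by (auto simp: cover_def sin_diff tan_def field_simps)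
  qed
  also have "\<dots> \<longleftrightarrow> (\<exists>k::int. x = y + k * pi)"
    by (auto simp: sin_zero_iff_int2 algebra_simps)
  finally show ?thesis .
qed

lemma cover_periodic [simp]: "cover (x + of_int k * pi) = cover x"
  using cover_eq_iff by blast

lemma cover_surj: "\<exists>x. cover x = p"
  by (metis chart_exhaust cover_lift)

lemma cover_eq_near:
  assumes "cover x = cover y" "\<bar>x - y\<bar> < pi"
  shows "x = y"
proof -
  obtain k :: int where k: "x = y + k * pi" using assms cover_eq_iff by blast
  then have "\<bar>real_of_int k\<bar> * pi < 1 * pi" using assms by (simp add: abs_mult)
  then have "\<bar>real_of_int k\<bar> < 1" by (simp only: mult_less_cancel_right) auto
  then show ?thesis using k by simp
qed

lemma inj_on_cover_ball:
  assumes "r \<le> pi / 2"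
  shows "inj_on cover (ball a r)"
proof (intro inj_onI cover_eq_near)
  fix x y assume "x \<in> ball a r" "y \<in> ball a r"
  then show "\<bar>x - y\<bar> < pi"
    using dist_triangle3[of x y a] assms unfolding dist_real_def mem_ball by linarith
qed

lemma continuous_on_lift: "continuous_on UNIV (lift c)"
  unfolding lift_def by (cases c; simp; intro continuous_intros)

lemma has_derivative_lift:
  "(lift c has_real_derivative (if c then - inverse (1 + u\<^sup>2) else inverse (1 + u\<^sup>2))) (at u within S)"
  unfolding lift_def by (cases c; auto intro!: derivative_eq_intros)

text \<open>These are the identities 1/cos^2 = 1 + tan^2 and 1/sin^2 = 1 + cot^2, which express the
  derivative of the coordinate by the parameter value itself.\<close>

lemma coord_den_square:
  assumes "coord_den c x \<noteq> (0::real)"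
  shows "inverse ((coord_den c x)\<^sup>2) = 1 + (coord c x)\<^sup>2"
  using assms sin_cos_squared_add[of x]
  by (cases c) (simp_all add: coord_den_def coord_def tan_def cot_def field_simps)

lemma has_derivative_coord:
  fixes z :: "'a::{real_normed_field,banach}"
  assumes "coord_den c z \<noteq> 0"
  shows "(coord c has_field_derivative
            (if c then - inverse ((coord_den c z)\<^sup>2) else inverse ((coord_den c z)\<^sup>2))) (at z)"
  using assms DERIV_cot[of z] DERIV_tan[of z] by (cases c) (auto simp: coord_den_def coord_def[abs_def])

lemma open_coord_den: "open {z::'a::{real_normed_field,banach}. coord_den c z \<noteq> 0}"
  unfolding coord_den_def
  by (cases c; simp; intro open_Collect_neq continuous_intros)

text \<open>In either chart the preimage of the image of \<open>W\<close> is the union, over all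
  integers \<open>k\<close>, of the preimages of \<open>W\<close> under the branches
  \<open>lift c u + k * pi\<close>. Openness later yields continuous local inverses and pushes
  separations down to the circle.\<close>

lemma open_map_cover: "open W \<Longrightarrow> openin circle_top (cover ` W)"
  unfolding openin_compactification_iff
proof
  fix c assume W: "open W"
  have "{u. chart c u \<in> cover ` W} = (\<Union>k::int. (\<lambda>u. lift c u + k * pi) -` W)"
  proof (intro equalityI subsetI)
    fix u assume "u \<in> {u. chart c u \<in> cover ` W}"
    then obtain x where x: "x \<in> W" "cover x = cover (lift c u)" by auto
    then obtain k :: int where "x = lift c u + k * pi" using x(2) unfolding cover_eq_iff by blast
    then show "u \<in> (\<Union>k::int. (\<lambda>u. lift c u + k * pi) -` W)" using x by auto
  next
    fix u assume "u \<in> (\<Union>k::int. (\<lambda>u. lift c u + k * pi) -` W)"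
    then obtain k :: int where "lift c u + k * pi \<in> W" by auto
    then have "cover (lift c u + k * pi) \<in> cover ` W" by blast
    then show "u \<in> {u. chart c u \<in> cover ` W}" by simp
  qed
  moreover have "open ((\<lambda>u. lift c u + k * pi) -` W)" for k :: int
    by (intro open_vimage W continuous_intros continuous_on_lift)
  ultimately show "open {u. chart c u \<in> cover ` W}" by auto
qed

lemma continuous_map_cover: "continuous_map euclidean circle_top cover"
  unfolding continuous_map_def
proof (intro conjI allI impI)
  fix U :: "real option set" assume U: "openin circle_top U"
  have "{x. cover x \<in> U} = (\<Union>c. {x. coord_den c x \<noteq> 0} \<inter> coord c -` {u. chart c u \<in> U})"
  proof (intro equalityI subsetI)
    fix x assume "x \<in> {x. cover x \<in> U}"
    moreover obtain c where "coord_den c x \<noteq> 0"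
      by (metis chart_exhaust cover_eq_chartD(1))
    ultimately show "x \<in> (\<Union>c. {x. coord_den c x \<noteq> 0} \<inter> coord c -` {u. chart c u \<in> U})"
      using cover_eq_chart by fastforce
  qed (auto simp: cover_eq_chart)
  moreover have "open ({x. coord_den c x \<noteq> 0} \<inter> coord c -` {u. chart c u \<in> U})" for c
  proof -
    have "continuous_on {x. coord_den c x \<noteq> (0::real)} (coord c)"
      by (auto intro!: continuous_at_imp_continuous_on DERIV_isCont dest: has_derivative_coord)
    then show ?thesis
      using U open_coord_den[of c] unfolding openin_compactification_iff
      by (metis Int_commute continuous_on_open_vimage)
  qed
  ultimately show "openin euclidean {x \<in> topspace euclidean. cover x \<in> U}" by auto
qed (auto simp: UNIV_option_conv [symmetric])

subsection \<open>Local holomorphic forms\<close>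

text \<open>Away from poles the finite value is already holomorphic; at a pole its reciprocal is,
  with an isolated zero. Injectivity passes from \<open>g\<close> to \<open>f\<close> because
  \<open>f y = f z\<close> forces \<open>g y = g z\<close>.\<close>

lemma plane_meromorphic_inj_local_chart:
  assumes mero: "plane_meromorphic_on g A" and "open A" "w \<in> A" and inj: "inj_on g A"
  obtains e f b where "e > 0" "ball w e \<subseteq> A" "f holomorphic_on ball w e" "inj_on f (ball w e)"
    "\<And>z. z \<in> ball w e \<Longrightarrow> g z = chart b (f z)"
proof -
  define F where "F = fin_val g"
  have nice: "F nicely_meromorphic_on A" and pole: "\<And>z. z \<in> A \<Longrightarrow> g z = None \<longleftrightarrow> is_pole F z"
    using mero by (auto simp: plane_meromorphic_on_def F_def)
  have fin: "g z = Some (F z)" if "z \<in> A" "\<not> is_pole F z" for z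
    using pole[OF that(1)] that(2) by (auto simp: F_def fin_val_def split: option.splits)
  have injI: "inj_on f (ball w e)"
    if "ball w e \<subseteq> A" "\<And>z. z \<in> ball w e \<Longrightarrow> g z = chart b (f z)" for e f b
  proof (rule inj_onI)
    fix y z assume "y \<in> ball w e" "z \<in> ball w e" "f y = f z"
    then show "y = z" using that inj by (metis inj_onD subsetD)
  qed
  show ?thesis
  proof (cases "is_pole F w")
    case False
    then have "F analytic_on {w}"
      using nicely_meromorphic_on_imp_analytic_at[OF nice \<open>w \<in> A\<close>] by blast
    then obtain e1 where e1: "e1 > 0" "F holomorphic_on ball w e1" unfolding analytic_on_def by auto
    obtain e2 where e2: "e2 > 0" "ball w e2 \<subseteq> A" using assms openE by blast
    define e where "e = min e1 e2"
    have e: "e > 0" "ball w e \<subseteq> A" "F holomorphic_on ball w e"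
      using e1 e2 by (auto simp: e_def elim!: holomorphic_on_subset)
    have g: "g z = chart False (F z)" if "z \<in> ball w e" for z
    proof -
      have "\<not> is_pole F z" using not_is_pole_holomorphic[OF open_ball that e(3)] .
      then show ?thesis using fin e(2) that by auto
    qed
    show ?thesis using that[OF e(1,2,3) injI[OF e(2) g]] g by blast
  next
    case True
    define G where "G z = inverse (F z)" for z
    have niceG: "G nicely_meromorphic_on A"
      unfolding G_def by (rule nicely_meromorphic_on_inverse[OF nice])
    have iso: "isolated_zero G w"
      unfolding G_def using is_pole_imp_isolated_zero_inverse[OF True] .
    then have "\<not> is_pole G w" using pole_is_not_zero by blast
    then have "G analytic_on {w}"
      using nicely_meromorphic_on_imp_analytic_at[OF niceG \<open>w \<in> A\<close>] by blast
    then obtain e1 where e1: "e1 > 0" "G holomorphic_on ball w e1" unfolding analytic_on_def by auto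
    obtain e2 where e2: "e2 > 0" "ball w e2 \<subseteq> A" using assms openE by blast
    \<comment> \<open>Excluding further zeros of \<open>G\<close> makes \<open>w\<close> the only
      pole of \<open>F\<close> in the ball, so that elsewhere \<open>g\<close> has the finite value
      \<open>F z\<close>.\<close>
    have "eventually (\<lambda>z. G z \<noteq> 0) (at w)" using iso by (simp add: isolated_zero_def)
    then obtain e3 where e3: "e3 > 0" "\<And>z. z \<noteq> w \<Longrightarrow> dist z w < e3 \<Longrightarrow> G z \<noteq> 0"
      unfolding eventually_at by blast
    define e where "e = min e1 (min e2 e3)"
    have e: "e > 0" "ball w e \<subseteq> A" "G holomorphic_on ball w e"
      using e1 e2 e3 by (auto simp: e_def elim!: holomorphic_on_subset)
    have g: "g z = chart True (G z)" if z: "z \<in> ball w e" for z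
    proof (cases "z = w")
      case True
      \<comment> \<open>Two default values cooperate: \<open>F\<close> is normalised to 0 at its
        pole, and \<open>inverse 0 = 0\<close>, so \<open>G\<close> has at \<open>w\<close> the
        value 0 that the chart sends to infinity.\<close>
      have "F w = 0" using is_pole_zero_at_nicely_mero[OF nice \<open>is_pole F w\<close> \<open>w \<in> A\<close>] .
      moreover have "g w = None" using pole \<open>w \<in> A\<close> \<open>is_pole F w\<close> by blast
      ultimately show ?thesis using True by (simp add: G_def)
    next
      case False
      have zA: "z \<in> A" using e(2) z by blast
      have G0: "G z \<noteq> 0" using e3(2)[OF False] z by (simp add: e_def dist_commute)
      then have "\<not> is_pole F z"
        using is_pole_zero_at_nicely_mero[OF nice _ zA] by (auto simp: G_def)
      then have "g z = Some (F z)" using fin zA by blast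
      then show ?thesis using G0 by (simp add: chart_True_nonzero G_def divide_inverse)
    qed
    show ?thesis using that[OF e(1,2,3) injI[OF e(2) g]] g by blast
  qed
qed

text \<open>\<open>f\<close> lives on a full complex disc, while agreement is required only at real
  points of \<open>S\<close>, so the same disc serves endpoints and subsets of \<open>S\<close>. The
  flag \<open>b\<close> selects the reciprocal of \<open>f\<close> as the value of the curve; zeros
  of \<open>f\<close> are then passages through infinity.\<close>

definition holomorphic_form ::
    "(real \<Rightarrow> complex option) \<Rightarrow> real set \<Rightarrow> real \<Rightarrow> real \<Rightarrow> (complex \<Rightarrow> complex) \<Rightarrow> bool \<Rightarrow> bool" where
  "holomorphic_form g S x e f b \<longleftrightarrow>
     e > 0 \<and> f holomorphic_on ball (of_real x) e \<and> inj_on f (ball (of_real x) e) \<and>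
     (\<forall>y\<in>S. \<bar>y - x\<bar> < e \<longrightarrow> g y = chart b (f (of_real y)))"

lemma holomorphic_form_subset:
  "\<lbrakk>holomorphic_form g S x e f b; T \<subseteq> S; 0 < d; d \<le> e\<rbrakk> \<Longrightarrow> holomorphic_form g T x d f b"
  unfolding holomorphic_form_def
  by (auto elim: holomorphic_on_subset inj_on_subset)

lemma analytic_curve_chart_form:
  assumes "analytic_curve I \<gamma>" "chart c u \<in> I"
  shows "\<exists>e f b. holomorphic_form (\<lambda>y. \<gamma> (chart c y)) {y. chart c y \<in> I} u e f b"
proof -
  obtain \<Delta> V \<phi> where \<Delta>: "openin (subtopology circle_top I) \<Delta>" "chart c u \<in> \<Delta>"
    and V: "openin sphere_top V" "real_to_sphere ` \<Delta> \<subseteq> V"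
    and \<phi>: "sphere_meromorphic_on \<phi> V" "inj_on \<phi> V" "\<And>t. t \<in> \<Delta> \<Longrightarrow> \<phi> (real_to_sphere t) = \<gamma> t"
    using assms unfolding analytic_curve_def by meson
  obtain W where W: "openin circle_top W" "\<Delta> = W \<inter> I"
    using \<Delta>(1) unfolding openin_subtopology by blast
  define A where "A = {z. chart c z \<in> V}"
  have "open A" using V(1) unfolding A_def openin_compactification_iff by blast
  have "of_real u \<in> A"
    using V(2) \<Delta>(2) unfolding A_def by (metis image_subset_iff mem_Collect_eq real_to_sphere_chart)
  have "plane_meromorphic_on (\<lambda>z. \<phi> (chart c z)) A"
    using \<phi>(1) unfolding A_def sphere_meromorphic_on_def by (cases c) (auto simp: chart_def)
  moreover have "inj_on (\<lambda>z. \<phi> (chart c z)) A"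
    using \<phi>(2) unfolding A_def inj_on_def by (metis chart_eq_iff mem_Collect_eq)
  ultimately obtain e f b where e: "e > 0" "ball (of_real u) e \<subseteq> A" "f holomorphic_on ball (of_real u) e"
    "inj_on f (ball (of_real u) e)" and fb: "\<And>z. z \<in> ball (of_real u) e \<Longrightarrow> \<phi> (chart c z) = chart b (f z)"
    using plane_meromorphic_inj_local_chart[OF _ \<open>open A\<close> \<open>of_real u \<in> A\<close>] by metis
  have "open {y. chart c y \<in> W}" using W(1) unfolding openin_compactification_iff by blast
  then obtain d where d: "d > 0" "ball u d \<subseteq> {y. chart c y \<in> W}"
    using \<Delta>(2) W(2) by (metis IntD1 mem_Collect_eq openE)
  have "holomorphic_form (\<lambda>y. \<gamma> (chart c y)) {y. chart c y \<in> I} u (min d e) f b"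
    unfolding holomorphic_form_def
  proof (intro conjI ballI impI)
    fix y assume y: "y \<in> {y. chart c y \<in> I}" "\<bar>y - u\<bar> < min d e"
    then have "y \<in> ball u d" by (simp add: dist_real_def abs_minus_commute)
    then have "chart c y \<in> \<Delta>" using d(2) W(2) y(1) by blast
    then have "\<gamma> (chart c y) = \<phi> (chart c (of_real y))" using \<phi>(3) by fastforce
    also have "\<dots> = chart b (f (of_real y))"
      using y by (intro fb) (simp add: dist_real_def abs_minus_commute)
    finally show "\<gamma> (chart c y) = chart b (f (of_real y))" .
  qed (use d e in \<open>auto elim: holomorphic_on_subset inj_on_subset\<close>)
  then show ?thesis by blast
qed

text \<open>The derivative of \<open>coord c\<close> does not vanish, so on a small complex disc
  this map is injective and stays in the disc of \<open>f\<close>; the composite is then injective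
  and holomorphic.\<close>

lemma holomorphic_form_coord:
  assumes form: "holomorphic_form (\<lambda>y. \<gamma> (chart c y)) {y. chart c y \<in> I} (coord c x) e f b"
    and den: "coord_den c x \<noteq> 0"
  shows "\<exists>d. holomorphic_form (\<lambda>y. \<gamma> (cover y)) {y. cover y \<in> I} x d (\<lambda>z. f (coord c z)) b"
proof -
  define D where "D = {z::complex. coord_den c z \<noteq> 0}"
  have "open D" unfolding D_def by (rule open_coord_den)
  have "of_real x \<in> D" using den unfolding D_def by (simp add: coord_den_of_real)
  have holD: "coord c holomorphic_on D"
    unfolding D_def holomorphic_on_def field_differentiable_def
    by (auto intro!: exI dest!: has_derivative_coord intro: has_field_derivative_at_within)
  have "deriv (coord c) (of_real x :: complex) \<noteq> 0"
    using DERIV_imp_deriv[OF has_derivative_coord[of c "of_real x :: complex"]] den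
    by (auto simp: coord_den_of_real)
  then obtain r where r: "r > 0" "ball (of_real x) r \<subseteq> D" "inj_on (coord c) (ball (of_real x :: complex) r)"
    using has_complex_derivative_locally_injective[OF holD \<open>of_real x \<in> D\<close> \<open>open D\<close>] by blast
  have "isCont (coord c) (of_real x :: complex)"
    using DERIV_isCont[OF has_derivative_coord[of c "of_real x :: complex"]] den
    by (auto simp: coord_den_of_real)
  moreover have "e > 0" using form by (simp add: holomorphic_form_def)
  ultimately obtain d0 where d0: "d0 > 0"
    "\<And>z::complex. dist z (of_real x) < d0 \<Longrightarrow> dist (coord c z) (coord c (of_real x :: complex)) < e"
    unfolding continuous_at_eps_delta by blast
  define d where "d = min r d0"
  have maps: "coord c z \<in> ball (of_real (coord c x)) e" if "(z::complex) \<in> ball (of_real x) d" for z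
    using d0(2)[of z] that by (simp add: d_def coord_of_real dist_commute)
  have "holomorphic_form (\<lambda>y. \<gamma> (cover y)) {y. cover y \<in> I} x d (\<lambda>z. f (coord c z)) b"
    unfolding holomorphic_form_def
  proof (intro conjI ballI impI)
    show "d > 0" using r d0 by (simp add: d_def)
    have "(f \<circ> coord c) holomorphic_on ball (of_real x) d"
    proof (rule holomorphic_on_compose_gen)
      show "coord c holomorphic_on ball (of_real x) d"
        using holD r(2) by (rule_tac holomorphic_on_subset) (auto simp: d_def)
      show "f holomorphic_on ball (of_real (coord c x)) e" using form by (simp add: holomorphic_form_def)
    qed (use maps in blast)
    then show "(\<lambda>z. f (coord c z)) holomorphic_on ball (of_real x) d" by (simp add: o_def)
    show "inj_on (\<lambda>z. f (coord c z)) (ball (of_real x) d)"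
    proof (rule inj_onI)
      fix y z assume yz: "y \<in> ball (of_real x) d" "z \<in> ball (of_real x) d" "f (coord c y) = f (coord c z)"
      then have "coord c y = coord c z"
        using form maps unfolding holomorphic_form_def by (metis inj_onD)
      then show "y = z" using yz r(3) by (auto simp: d_def dest: inj_onD)
    qed
    fix y assume y: "y \<in> {y. cover y \<in> I}" "\<bar>y - x\<bar> < d"
    have yb: "of_real y \<in> ball (of_real x :: complex) d"
      using y(2) by (simp add: dist_real_def abs_minus_commute)
    then have "of_real y \<in> ball (of_real x :: complex) r" by (simp add: d_def)
    then have "coord_den c (of_real y :: complex) \<noteq> 0" using r(2) unfolding D_def by blast
    then have cy: "cover y = chart c (coord c y)"
      by (intro cover_eq_chart) (simp add: coord_den_of_real)
    moreover have "\<bar>coord c y - coord c x\<bar> < e"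
      using maps[OF yb] by (simp add: coord_of_real dist_real_def abs_minus_commute)
    ultimately show "\<gamma> (cover y) = chart b (f (coord c (of_real y)))"
      using form y(1) by (auto simp: holomorphic_form_def coord_of_real)
  qed
  then show ?thesis by blast
qed

lemma analytic_curve_cover_form:
  assumes "analytic_curve I \<gamma>" "cover x \<in> I"
  shows "\<exists>e f b. holomorphic_form (\<lambda>y. \<gamma> (cover y)) {y. cover y \<in> I} x e f b"
proof -
  obtain c u where cu: "cover x = chart c u" by (metis chart_exhaust)
  note * = cover_eq_chartD[OF cu]
  show ?thesis
    using analytic_curve_chart_form[OF assms(1), of c u] assms(2) holomorphic_form_coord[of \<gamma> c I x]
    unfolding cu[symmetric] *(2) using *(1) cu *(2) by metis
qed

section \<open>Spherical speed in local forms and under change of parameter\<close>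

lemma holomorphic_form_deriv:
  assumes "holomorphic_form g S x e f b"
  shows "(f has_field_derivative deriv f (of_real x)) (at (of_real x))" "deriv f (of_real x) \<noteq> 0"
proof -
  have f: "e > 0" "f holomorphic_on ball (of_real x) e" "inj_on f (ball (of_real x) e)"
    using assms by (auto simp: holomorphic_form_def)
  show "(f has_field_derivative deriv f (of_real x)) (at (of_real x))"
    using f by (intro holomorphic_derivI[OF f(2)]) auto
  show "deriv f (of_real x) \<noteq> 0"
    using holomorphic_injective_imp_regular[OF f(2) _ f(3)] f(1) by simp
qed

lemma finite_speed_eq:
  assumes "(\<phi> has_vector_derivative D) (at x within S)" "at x within S \<noteq> bot" "x \<in> S" "e > 0"
    and "\<And>y. y \<in> S \<Longrightarrow> \<bar>y - x\<bar> < e \<Longrightarrow> g y = Some (\<phi> y)"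
  shows "finite_speed g S x = norm D / (1 + (norm (\<phi> x))\<^sup>2)"
proof -
  have "((\<lambda>v. the (g v)) has_vector_derivative D) (at x within S)"
    by (rule has_vector_derivative_transform_within[OF assms(1,4,3)])
       (simp add: assms(5) dist_real_def)
  then have "vector_derivative (\<lambda>v. the (g v)) (at x within S) = D"
    using assms(2) by (rule vector_derivative_within[rotated])
  then show ?thesis using assms(3-5) by (simp add: finite_speed_def)
qed

text \<open>Only the case \<open>g = 1 / f\<close> with \<open>f\<close> nonzero at \<open>x\<close>
  needs a computation: the definition then measures \<open>g\<close> itself and not its reciprocal,
  and the factor 1 / |w|^2 of the derivative is absorbed by the denominator.\<close>

lemma spherical_speed_eq:
  assumes form: "holomorphic_form g S x e f b" and lim: "at x within S \<noteq> bot" and "x \<in> S"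
  shows "spherical_speed g S x = norm (deriv f (of_real x)) / (1 + (norm (f (of_real x)))\<^sup>2)"
proof -
  define D where "D = deriv f (of_real x)"
  define w where "w = f (of_real x)"
  have e: "e > 0" and g: "\<And>y. y \<in> S \<Longrightarrow> \<bar>y - x\<bar> < e \<Longrightarrow> g y = chart b (f (of_real y))"
    using form by (auto simp: holomorphic_form_def)
  have f': "(f has_field_derivative D) (at (of_real x))"
    unfolding D_def by (rule holomorphic_form_deriv[OF form])
  have vec: "((\<lambda>y. f (of_real y)) has_vector_derivative D) (at x within S)"
    by (rule has_vector_derivative_real_field[OF f'])
  have gx: "g x = chart b w" using g[OF \<open>x \<in> S\<close>] e by (simp add: w_def)
  consider "\<not> b" | "b" "w = 0" | "b" "w \<noteq> 0" by blast
  then show ?thesis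
  proof cases
    case 1
    have "finite_speed g S x = norm D / (1 + (norm (f (of_real x)))\<^sup>2)"
      by (rule finite_speed_eq[OF vec lim \<open>x \<in> S\<close> e]) (use g 1 in simp)
    then show ?thesis using gx 1 by (simp add: spherical_speed_def D_def)
  next
    case 2
    have "finite_speed (\<lambda>v. recip (g v)) S x = norm D / (1 + (norm (f (of_real x)))\<^sup>2)"
      by (rule finite_speed_eq[OF vec lim \<open>x \<in> S\<close> e]) (use g 2 in simp)
    then show ?thesis using gx 2 by (simp add: spherical_speed_def D_def)
  next
    case 3
    have "isCont f (of_real x)" using f' DERIV_isCont by blast
    then obtain d where d: "d > 0" "\<And>z. dist z (of_real x) < d \<Longrightarrow> dist (f z) w < norm w"
      using 3 unfolding continuous_at_eps_delta w_def by (metis zero_less_norm_iff)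
    have nz: "f (of_real y) \<noteq> 0" if "\<bar>y - x\<bar> < d" for y
      using d(2)[of "of_real y"] that by (auto simp: dist_real_def)
    have "((\<lambda>z. 1 / f z) has_field_derivative - D / w\<^sup>2) (at (of_real x))"
      using 3 by (auto intro!: derivative_eq_intros f' simp: w_def power2_eq_square)
    then have vec': "((\<lambda>y. 1 / f (of_real y)) has_vector_derivative - D / w\<^sup>2) (at x within S)"
      by (rule has_vector_derivative_real_field)
    have "finite_speed g S x = norm (- D / w\<^sup>2) / (1 + (norm (1 / f (of_real x)))\<^sup>2)"
      by (rule finite_speed_eq[OF vec' lim \<open>x \<in> S\<close>, of "min d e"])
         (use g 3 d e nz in \<open>auto simp: chart_True_nonzero\<close>)
    also have "\<dots> = norm D / (1 + (norm w)\<^sup>2)"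
      using 3 by (simp add: w_def[symmetric] norm_divide norm_power field_simps)
    finally show ?thesis using gx 3 by (simp add: spherical_speed_def chart_True_nonzero D_def w_def)
  qed
qed

text \<open>Speeds are derivatives within a set and are determined at its limit points, so these
  must be carried from the line to a chart. Staying closer than pi keeps \<open>cover\<close>
  injective, and nearby points do not collapse.\<close>

lemma islimpt_coord_image:
  assumes lim: "x islimpt X" and den: "coord_den c x \<noteq> 0"
    and X: "\<And>y. y \<in> X \<Longrightarrow> cover y \<in> A"
  shows "coord c x islimpt {y. chart c y \<in> A}"
  unfolding islimpt_approachable
proof (intro allI impI)
  fix e :: real assume "e > 0"
  have "isCont (coord c) x" using has_derivative_coord[OF den] DERIV_isCont by blast
  then obtain d1 where d1: "d1 > 0" "\<And>y. dist y x < d1 \<Longrightarrow> dist (coord c y) (coord c x) < e"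
    using \<open>e > 0\<close> unfolding continuous_at_eps_delta by blast
  obtain d2 where d2: "d2 > 0" "ball x d2 \<subseteq> {y. coord_den c y \<noteq> 0}"
    using open_coord_den[of c] den by (metis mem_Collect_eq openE)
  obtain y where y: "y \<in> X" "y \<noteq> x" "dist y x < min d1 (min d2 pi)"
    using lim d1(1) d2(1) unfolding islimpt_approachable by (metis min_less_iff_conj pi_gt_zero)
  have "y \<in> ball x d2" using y(3) by (simp add: dist_commute)
  then have cy: "cover y = chart c (coord c y)" using d2(2) by (intro cover_eq_chart) blast
  have "coord c y \<noteq> coord c x"
  proof
    assume "coord c y = coord c x"
    then have "cover y = cover x" using cy cover_eq_chart[OF den] by simp
    then show False using cover_eq_near[of y x] y by (simp add: dist_real_def)
  qed
  moreover have "chart c (coord c y) \<in> A" using X[OF y(1)] cy by simp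
  moreover have "dist (coord c y) (coord c x) < e" using d1(2) y(3) by simp
  ultimately show "\<exists>z\<in>{y. chart c y \<in> A}. z \<noteq> coord c x \<and> dist z (coord c x) < e" by blast
qed

text \<open>By the chain rule, passing to the angle multiplies the derivative of the form by that of
  \<open>coord c\<close>, of modulus 1 + u^2. The two sets are linked only by \<open>cover\<close>
  mapping \<open>X\<close> into \<open>A\<close>: both speeds come from the same form and do not
  depend on the set.\<close>

lemma spherical_speed_cover:
  assumes an: "analytic_curve I \<gamma>" and cu: "cover x = chart c u" and lim: "x islimpt X" and "x \<in> X"
    and XA: "\<And>y. y \<in> X \<Longrightarrow> cover y \<in> A" and "A \<subseteq> I"
  shows "spherical_speed (\<lambda>y. \<gamma> (cover y)) X x =
           spherical_speed (\<lambda>y. \<gamma> (chart c y)) {y. chart c y \<in> A} u * (1 + u\<^sup>2)"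
proof -
  note den = cover_eq_chartD(1)[OF cu] and u = cover_eq_chartD(2)[OF cu]
  have "chart c u \<in> A" using XA \<open>x \<in> X\<close> cu by metis
  then obtain e f b where form: "holomorphic_form (\<lambda>y. \<gamma> (chart c y)) {y. chart c y \<in> I} u e f b"
    using analytic_curve_chart_form[OF an] \<open>A \<subseteq> I\<close> by blast
  obtain d where form': "holomorphic_form (\<lambda>y. \<gamma> (cover y)) {y. cover y \<in> I} x d (\<lambda>z. f (coord c z)) b"
    using holomorphic_form_coord[OF _ den] form u by metis
  have "u islimpt {y. chart c y \<in> A}" using islimpt_coord_image[OF lim den XA] u by simp
  then have "at u within {y. chart c y \<in> A} \<noteq> bot" by (simp add: trivial_limit_within)
  then have 1: "spherical_speed (\<lambda>y. \<gamma> (chart c y)) {y. chart c y \<in> A} u =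
      norm (deriv f (of_real u)) / (1 + (norm (f (of_real u)))\<^sup>2)"
    using form \<open>A \<subseteq> I\<close> \<open>chart c u \<in> A\<close>
    by (intro spherical_speed_eq[of _ _ _ e f b]) (auto simp: holomorphic_form_def)
  have 2: "spherical_speed (\<lambda>y. \<gamma> (cover y)) X x =
      norm (deriv (\<lambda>z. f (coord c z)) (of_real x)) / (1 + (norm (f (coord c (of_real x))))\<^sup>2)"
    using form' \<open>A \<subseteq> I\<close> \<open>x \<in> X\<close> XA lim
    by (intro spherical_speed_eq[of _ _ _ d _ b]) (auto simp: holomorphic_form_def trivial_limit_within)
  define s :: complex where "s = (if c then -1 else 1)"
  have "((\<lambda>z. f (coord c z)) has_field_derivative
      deriv f (of_real u) * (s * inverse ((coord_den c (of_real x))\<^sup>2))) (at (of_real x))"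
  proof (rule DERIV_chain2[where g = "coord c"])
    show "(f has_field_derivative deriv f (of_real u)) (at (coord c (of_real x)))"
      using holomorphic_form_deriv(1)[OF form] u by (simp add: coord_of_real)
    show "(coord c has_field_derivative s * inverse ((coord_den c (of_real x))\<^sup>2)) (at (of_real x))"
      using has_derivative_coord[of c "of_real x :: complex"] den
      by (cases c) (simp_all add: s_def coord_den_of_real)
  qed
  then have "deriv (\<lambda>z. f (coord c z)) (of_real x) =
      deriv f (of_real u) * (s * inverse ((coord_den c (of_real x))\<^sup>2))"
    by (rule DERIV_imp_deriv)
  moreover have "norm (s * inverse ((coord_den c (of_real x))\<^sup>2)) = 1 + u\<^sup>2"
  proof -
    have "norm (s * inverse ((coord_den c (of_real x))\<^sup>2)) = inverse ((coord_den c x)\<^sup>2)"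
      by (simp add: s_def coord_den_of_real norm_mult norm_inverse norm_power)
    then show ?thesis using coord_den_square[OF den] u by simp
  qed
  ultimately have "norm (deriv (\<lambda>z. f (coord c z)) (of_real x)) = norm (deriv f (of_real u)) * (1 + u\<^sup>2)"
    by (simp only: norm_mult)
  then show ?thesis using 1 2 u by (simp add: coord_of_real)
qed

section \<open>Holomorphic extension of the speed by reflection\<close>

lemma analytic_on_cnj_cnj:
  assumes "f analytic_on {of_real x}"
  shows "(\<lambda>z. cnj (f (cnj z))) analytic_on {complex_of_real x}"
proof -
  obtain e where e: "e > 0" "f holomorphic_on ball (of_real x) e"
    using assms unfolding analytic_on_def by auto
  \<comment> \<open>The disc is centred on the real axis and hence invariant under conjugation, so
    the reflected function lives on the same disc.\<close>
  have "cnj ` ball (of_real x) e \<subseteq> ball (of_real x) e"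
  proof clarify
    fix z assume "z \<in> ball (of_real x :: complex) e"
    moreover have "dist (of_real x) (cnj z) = dist (of_real x) z"
      unfolding dist_norm by (metis complex_cnj_complex_of_real complex_cnj_diff complex_mod_cnj)
    ultimately show "cnj z \<in> ball (of_real x) e" by simp
  qed
  then have "f holomorphic_on cnj ` ball (of_real x) e" using e(2) holomorphic_on_subset by blast
  then have "(cnj \<circ> f \<circ> cnj) holomorphic_on ball (of_real x) e"
    by (rule holomorphic_on_compose_cnj_cnj) simp
  then show ?thesis using e(1) unfolding analytic_on_def o_def by auto
qed

text \<open>On the real axis \<open>cnj (f (cnj z))\<close> is the conjugate of \<open>f z\<close>, so that \<open>\<bar>f\<bar>\<^sup>2\<close> and \<open>\<bar>f'\<bar>\<^sup>2\<close> extend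
  holomorphically off it.\<close>

lemma speed_holomorphic_extension:
  assumes form: "holomorphic_form g S x e f b"
  obtains d P where "0 < d" "d \<le> e" "P holomorphic_on ball (of_real x) d" "inj_on P (ball (of_real x) d)"
    "P (of_real x) = of_real s"
    "\<And>y. \<bar>y - x\<bar> < d \<Longrightarrow> (P has_field_derivative
        of_real (norm (deriv f (of_real y)) / (1 + (norm (f (of_real y)))\<^sup>2))) (at (of_real y))"
proof -
  define v where "v y = norm (deriv f (of_real y)) / (1 + (norm (f (of_real y)))\<^sup>2)" for y :: real
  define N where "N z = deriv f z * cnj (deriv f (cnj z))" for z
  define M where "M z = 1 + f z * cnj (f (cnj z))" for z
  have e: "e > 0" "f holomorphic_on ball (of_real x) e" using form by (auto simp: holomorphic_form_def)
  have N_real: "N (of_real y) = of_real ((norm (deriv f (of_real y)))\<^sup>2)" for y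
    by (simp only: N_def complex_norm_square complex_cnj_complex_of_real)
  have M_real: "M (of_real y) = of_real (1 + (norm (f (of_real y)))\<^sup>2)" for y
    by (simp only: M_def complex_norm_square complex_cnj_complex_of_real of_real_add of_real_1)
  have f_an: "f analytic_on {of_real x}" using e unfolding analytic_on_def by auto
  then have f'_an: "deriv f analytic_on {of_real x}" by (rule analytic_deriv)
  have N_an: "N analytic_on {of_real x}" unfolding N_def
    by (intro analytic_intros f'_an analytic_on_cnj_cnj)
  have M_an: "M analytic_on {of_real x}" unfolding M_def
    by (intro analytic_intros f_an analytic_on_cnj_cnj)
  \<comment> \<open>At the centre \<open>N\<close> is |f'|^2 > 0, which lies off the cut of
    \<open>csqrt\<close>; at real points the principal root of this square is |f'| itself.\<close>
  have "N (of_real x) \<notin> \<real>\<^sub>\<le>\<^sub>0"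
    unfolding N_real using holomorphic_form_deriv(2)[OF form] by (simp del: of_real_power)
  moreover have "M (of_real x) \<noteq> 0"
    unfolding M_real of_real_eq_0_iff using sum_power2_gt_zero_iff[of 1 "norm (f (of_real x))"] by simp
  ultimately have "(\<lambda>z. csqrt (N z) / M z) analytic_on {of_real x}"
    by (intro analytic_intros N_an M_an) auto
  then obtain r where r: "r > 0" "(\<lambda>z. csqrt (N z) / M z) holomorphic_on ball (of_real x) r"
    unfolding analytic_on_def by auto
  obtain P0 where P0: "\<And>z. z \<in> ball (of_real x) r \<Longrightarrow>
      (P0 has_field_derivative csqrt (N z) / M z) (at z within ball (of_real x) r)"
    using holomorphic_convex_primitive'[OF convex_ball open_ball r(2)] by blast
  \<comment> \<open>The additive constant gives \<open>P\<close> the value \<open>s\<close> at the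
    centre, so that it can be compared with an arc-length without a further shift.\<close>
  define P where "P z = P0 z - P0 (of_real x) + of_real s" for z
  have P': "(P has_field_derivative csqrt (N z) / M z) (at z)" if "z \<in> ball (of_real x) r" for z
  proof -
    have "(P0 has_field_derivative csqrt (N z) / M z) (at z)"
      using P0[OF that] unfolding at_within_open[OF that open_ball] .
    then have "((\<lambda>z. P0 z - P0 (of_real x) + of_real s) has_field_derivative csqrt (N z) / M z - 0 + 0) (at z)"
      by (intro DERIV_add DERIV_diff DERIV_const)
    then show ?thesis by (simp add: P_def[abs_def])
  qed
  have v: "csqrt (N (of_real y)) / M (of_real y) = of_real (v y)" for y
    unfolding N_real M_real v_def by (simp add: csqrt_of_real_nonneg del: of_real_power)
  have P_real: "(P has_field_derivative of_real (v y)) (at (of_real y))" if "\<bar>y - x\<bar> < r" for y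
    unfolding v[symmetric]
    by (rule P') (use that in \<open>simp add: dist_real_def abs_minus_commute\<close>)
  have P_hol: "P holomorphic_on ball (of_real x) r"
    using P' holomorphic_on_open by blast
  have "deriv P (of_real x) = of_real (v x)" using P_real[of x] r(1) by (simp add: DERIV_imp_deriv)
  moreover have "v x \<noteq> 0" using holomorphic_form_deriv(2)[OF form]
    by (simp add: v_def add_nonneg_eq_0_iff)
  ultimately have "deriv P (of_real x) \<noteq> 0" by simp
  moreover have "of_real x \<in> ball (complex_of_real x) r" using r(1) by simp
  ultimately obtain d where d: "d > 0" "inj_on P (ball (of_real x) d)"
    using has_complex_derivative_locally_injective[OF P_hol _ open_ball] by blast
  show ?thesis
  proof (rule that[of "min (min d r) e" P])
    show "P holomorphic_on ball (of_real x) (min (min d r) e)"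
      using P_hol by (rule holomorphic_on_subset) auto
    show "inj_on P (ball (of_real x) (min (min d r) e))"
      using d(2) by (rule inj_on_subset) auto
  qed (use d e r P_real in \<open>auto simp: P_def v_def\<close>)
qed

section \<open>From local forms back to analytic curves\<close>

text \<open>The disc of the form, viewed in the sphere, serves as \<open>V\<close> and avoids
  infinity. Meromorphy must still be checked in the chart 1/z, where the map comes from
  \<open>f (1 / z)\<close> on a set without 0. There, as on the disc, injectivity isolates every
  zero and so turns it into a genuine pole when \<open>b\<close> holds.\<close>

lemma analytic_curve_realI:
  assumes "\<And>s. s \<in> J \<Longrightarrow> \<exists>e f b. holomorphic_form g J s e f b"
  shows "analytic_curve (Some ` J) (\<lambda>p. g (the p))"
  unfolding analytic_curve_def
proof
  fix t0 assume "t0 \<in> Some ` J"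
  then obtain s where s: "s \<in> J" "t0 = Some s" by blast
  obtain e f b where form: "holomorphic_form g J s e f b" using assms[OF s(1)] by blast
  define B where "B = ball (complex_of_real s) e"
  \<comment> \<open>The value at \<open>\<infinity>\<close> lies outside the domain; it is chosen so that
    \<open>F (recip (Some z)) = chart b (f (1 / z))\<close> holds even for \<open>z = 0\<close>, where \<open>1 / z = 0\<close>.\<close>
  define F where "F p = chart b (f (case p of None \<Rightarrow> 0 | Some z \<Rightarrow> z))" for p
  have e: "e > 0" and hol: "f holomorphic_on B" and inj: "inj_on f B"
    using form by (auto simp: holomorphic_form_def B_def)
  have "open B" by (simp add: B_def)
  have f': "deriv f z \<noteq> 0" if "z \<in> B" for z
    using holomorphic_injective_imp_regular[OF hol \<open>open B\<close> inj that] .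
  \<comment> \<open>For \<open>b\<close> the finite value is \<open>inverse (h z)\<close>, again by
    \<open>inverse 0 = 0\<close>, and its poles are exactly the isolated zeros of
    \<open>h\<close>.\<close>
  have mero: "plane_meromorphic_on (\<lambda>z. chart b (h z)) A"
    if h: "h holomorphic_on A" "open A" and iso: "\<And>z. z \<in> A \<Longrightarrow> h z = 0 \<Longrightarrow> isolated_zero h z" for h A
  proof (cases b)
    case False
    have "fin_val (\<lambda>z. chart b (h z)) = h" using False by (auto simp: fin_val_def)
    moreover have "h nicely_meromorphic_on A"
      using h analytic_on_open analytic_on_imp_nicely_meromorphic_on by blast
    moreover have "\<not> is_pole h z" if "z \<in> A" for z using not_is_pole_holomorphic[OF h(2) that h(1)] .
    ultimately show ?thesis using False by (auto simp: plane_meromorphic_on_def)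
  next
    case True
    have 1: "fin_val (\<lambda>z. chart b (h z)) = (\<lambda>z. inverse (h z))"
      using True by (auto simp: fin_val_def chart_def recip_def divide_inverse fun_eq_iff)
    have "h nicely_meromorphic_on A"
      using h analytic_on_open analytic_on_imp_nicely_meromorphic_on by blast
    then have 2: "(\<lambda>z. inverse (h z)) nicely_meromorphic_on A"
      by (rule nicely_meromorphic_on_inverse)
    have "chart True (h z) = None \<longleftrightarrow> isolated_zero h z" if "z \<in> A" for z
    proof
      assume "chart True (h z) = None"
      then have "h z = 0" by (auto simp: chart_def recip_def split: if_splits)
      then show "isolated_zero h z" using iso that by blast
    next
      assume z: "isolated_zero h z"
      have "isCont h z"
        using h that holomorphic_on_imp_continuous_on continuous_on_eq_continuous_at by blast
      then have "h z = 0" using z zero_isolated_zero by blast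
      then show "chart True (h z) = None" by simp
    qed
    then show ?thesis using 1 2 True
      by (simp add: plane_meromorphic_on_def is_pole_inverse_iff)
  qed
  have iso: "isolated_zero h z"
    if h: "h holomorphic_on A" "open A" "inj_on h A" "z \<in> A" "h z = 0" for h A z
  proof -
    have "isCont h z"
      using h holomorphic_on_imp_continuous_on continuous_on_eq_continuous_at by blast
    then have "h \<midarrow>z\<rightarrow> 0" using h(5) by (simp add: isCont_def)
    moreover have "eventually (\<lambda>y. y \<in> A \<and> y \<noteq> z) (at z)"
      using h(2,4) eventually_at_in_open by fastforce
    then have "eventually (\<lambda>y. h y \<noteq> 0) (at z)"
      by eventually_elim (use h(3-5) in \<open>metis inj_onD\<close>)
    ultimately show ?thesis by (simp add: isolated_zero_def)
  qed
  have m1: "plane_meromorphic_on (\<lambda>z. F (Some z)) {z. Some z \<in> Some ` B}"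
  proof -
    have "{z. Some z \<in> Some ` B} = B" by auto
    then show ?thesis
      using mero[OF hol \<open>open B\<close>] iso[OF hol \<open>open B\<close> inj] by (simp add: F_def)
  qed
  have m2: "plane_meromorphic_on (\<lambda>z. F (recip (Some z))) {z. recip (Some z) \<in> Some ` B}"
  proof -
    define A where "A = {z::complex. recip (Some z) \<in> Some ` B}"
    have A: "z \<in> A \<longleftrightarrow> z \<noteq> 0 \<and> 1 / z \<in> B" for z by (auto simp: A_def recip_def)
    have "openin sphere_top (Some ` B)" using \<open>open B\<close> by simp
    then have "open {z. chart True z \<in> Some ` B}" unfolding openin_compactification_iff by blast
    then have "open A" by (simp add: A_def chart_def)
    have "(f \<circ> (\<lambda>z. 1 / z)) holomorphic_on A"
      by (rule holomorphic_on_compose_gen[OF _ hol]) (auto simp: A intro!: holomorphic_intros)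
    moreover have "inj_on (f \<circ> (\<lambda>z. 1 / z)) A"
    proof (rule inj_onI)
      fix y z assume "y \<in> A" "z \<in> A" and eq: "(f \<circ> (\<lambda>z. 1 / z)) y = (f \<circ> (\<lambda>z. 1 / z)) z"
      then have "1 / y \<in> B" "1 / z \<in> B" using A by blast+
      with inj eq[unfolded o_apply] have "1 / y = 1 / z" by (rule inj_onD)
      then show "y = z" by simp
    qed
    ultimately have "plane_meromorphic_on (\<lambda>z. chart b ((f \<circ> (\<lambda>z. 1 / z)) z)) A"
      using mero iso \<open>open A\<close> by blast
    moreover have "F (recip (Some z)) = chart b ((f \<circ> (\<lambda>z. 1 / z)) z)" for z
      by (simp add: F_def recip_def)
    ultimately show ?thesis by (simp add: A_def)
  qed
  show "\<exists>\<Delta> V \<phi>. openin (subtopology circle_top (Some ` J)) \<Delta> \<and> t0 \<in> \<Delta> \<and> openin sphere_top V \<and>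
      real_to_sphere ` \<Delta> \<subseteq> V \<and> sphere_meromorphic_on \<phi> V \<and> inj_on \<phi> V \<and>
      (\<forall>t\<in>\<Delta>. \<phi> (real_to_sphere t) = g (the t))"
  proof (rule exI[of _ "Some ` ball s e \<inter> Some ` J"], rule exI[of _ "Some ` B"], rule exI[of _ F],
      intro conjI)
    have "openin circle_top (Some ` ball s e)" by simp
    then show "openin (subtopology circle_top (Some ` J)) (Some ` ball s e \<inter> Some ` J)"
      by (rule openin_subtopology_Int)
    show "t0 \<in> Some ` ball s e \<inter> Some ` J" using s e by auto
    show "openin sphere_top (Some ` B)" using \<open>open B\<close> by simp
    show "real_to_sphere ` (Some ` ball s e \<inter> Some ` J) \<subseteq> Some ` B"
      by (auto simp: B_def)
    show "sphere_meromorphic_on F (Some ` B)"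
      using m1 m2 by (simp add: sphere_meromorphic_on_def)
    show "inj_on F (Some ` B)"
      using inj by (auto simp: F_def inj_on_def)
    show "\<forall>t\<in>Some ` ball s e \<inter> Some ` J. F (real_to_sphere t) = g (the t)"
      using form by (auto simp: F_def holomorphic_form_def dist_real_def abs_minus_commute)
  qed
qed

subsection \<open>Arc-length parametrizations are analytic\<close>

lemma holomorphic_form_recenter:
  assumes form: "holomorphic_form g S x e f b" and y: "\<bar>y - x\<bar> < e"
  shows "holomorphic_form g S y (e - \<bar>y - x\<bar>) f b"
proof -
  have "ball (complex_of_real y) (e - \<bar>y - x\<bar>) \<subseteq> ball (of_real x) e"
    unfolding ball_subset_ball_iff by (simp add: dist_real_def)
  then show ?thesis
    using form y unfolding holomorphic_form_def
    by (auto elim: holomorphic_on_subset inj_on_subset)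
qed

text \<open>At infinity the minus sign in the definition of arc-length meets the minus sign in the
  derivative of cot. They cancel, so on the line the derivative is the speed at every point without
  exception.\<close>

lemma arclength_cover_derivative:
  assumes an: "analytic_curve I \<gamma>" and len: "spherical_arclength A \<gamma> \<sigma>" and "A \<subseteq> I"
    and XA: "\<And>y. y \<in> X \<Longrightarrow> cover y \<in> A" and "x \<in> X" and lim: "x islimpt X"
  shows "((\<lambda>y. \<sigma> (cover y)) has_real_derivative spherical_speed (\<lambda>y. \<gamma> (cover y)) X x) (at x within X)"
proof -
  obtain c u where cu: "cover x = chart c u" "c \<Longrightarrow> u = 0" by (metis chart_exhaust)
  note den = cover_eq_chartD(1)[OF cu(1)] and u = cover_eq_chartD(2)[OF cu(1)]
  define v where "v = spherical_speed (\<lambda>y. \<gamma> (chart c y)) {y. chart c y \<in> A} u"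
  define s :: real where "s = (if c then -1 else 1)"
  \<comment> \<open>The coordinate is meaningful only where its denominator is nonzero; that set is
    open, so restricting to it leaves the derivative at \<open>x\<close> unchanged.\<close>
  define X' where "X' = X \<inter> {y. coord_den c y \<noteq> 0}"
  have xA: "chart c u \<in> A" using XA \<open>x \<in> X\<close> cu(1) by metis
  have "((\<lambda>y. \<sigma> (chart c y)) has_real_derivative s * v) (at u within {y. chart c y \<in> A})"
    using len cu(2) xA unfolding spherical_arclength_def v_def s_def
    by (cases c) (auto simp: chart_def recip_def)
  moreover have "coord c ` X' \<subseteq> {y. chart c y \<in> A}"
    using XA by (auto simp: X'_def cover_eq_chart[symmetric])
  ultimately have 1: "((\<lambda>y. \<sigma> (chart c y)) has_real_derivative s * v) (at (coord c x) within coord c ` X')"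
    unfolding u using DERIV_subset by blast
  have "(coord c has_real_derivative s * (1 + u\<^sup>2)) (at x)"
    using has_derivative_coord[OF den] coord_den_square[OF den] u by (cases c) (simp_all add: s_def)
  then have 2: "(coord c has_real_derivative s * (1 + u\<^sup>2)) (at x within X')"
    by (rule has_field_derivative_at_within)
  have "((\<lambda>y. \<sigma> (chart c y)) \<circ> coord c has_real_derivative s * v * (s * (1 + u\<^sup>2))) (at x within X')"
    by (rule DERIV_image_chain[OF 1 2])
  moreover have "s * v * (s * (1 + u\<^sup>2)) = v * (1 + u\<^sup>2)" by (simp add: s_def)
  ultimately have "((\<lambda>y. \<sigma> (chart c (coord c y))) has_real_derivative v * (1 + u\<^sup>2)) (at x within X')"
    by (simp add: o_def)
  then have "((\<lambda>y. \<sigma> (cover y)) has_real_derivative v * (1 + u\<^sup>2)) (at x within X')"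
    by (rule has_field_derivative_transform_within[OF _ zero_less_one])
       (use \<open>x \<in> X\<close> den in \<open>auto simp: X'_def cover_eq_chart\<close>)
  moreover have "at x within X' = at x within X"
    by (rule at_within_nhd[of x "{y. coord_den c y \<noteq> 0}"]) (use den open_coord_den in \<open>auto simp: X'_def\<close>)
  moreover have "spherical_speed (\<lambda>y. \<gamma> (cover y)) X x = v * (1 + u\<^sup>2)"
    unfolding v_def by (rule spherical_speed_cover[OF an cu(1) lim \<open>x \<in> X\<close> XA \<open>A \<subseteq> I\<close>])
  ultimately show ?thesis by simp
qed

text \<open>A ball of radius at most pi / 2 is no longer than one period, so \<open>cover\<close> is
  injective on it; as an open map it has a continuous inverse on the image.\<close>

lemma continuous_lift_through_cover:
  assumes h: "continuous_map (top_of_set T) circle_top h" and hT: "h ` T \<subseteq> cover ` ball x r" and "r \<le> pi / 2"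
  obtains \<xi> where "continuous_on T \<xi>" "\<And>s. s \<in> T \<Longrightarrow> \<xi> s \<in> ball x r" "\<And>s. s \<in> T \<Longrightarrow> cover (\<xi> s) = h s"
proof -
  have "\<forall>s\<in>T. \<exists>y. y \<in> ball x r \<and> cover y = h s" using hT by (metis imageE image_subset_iff)
  then obtain \<xi> where \<xi>: "\<And>s. s \<in> T \<Longrightarrow> \<xi> s \<in> ball x r" "\<And>s. s \<in> T \<Longrightarrow> cover (\<xi> s) = h s" by metis
  have uniq: "y = z" if "y \<in> ball x r" "z \<in> ball x r" "cover y = cover z" for y z
    using inj_on_cover_ball[OF \<open>r \<le> pi / 2\<close>] that by (metis inj_onD)
  have "openin (top_of_set T) (T \<inter> \<xi> -` U)" if "open U" for U
  proof -
    have "T \<inter> \<xi> -` U = {s \<in> T. h s \<in> cover ` (U \<inter> ball x r)}"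
    proof (intro set_eqI iffI)
      fix s assume "s \<in> T \<inter> \<xi> -` U"
      then have "s \<in> T" "cover (\<xi> s) \<in> cover ` (U \<inter> ball x r)" using \<xi>(1) by blast+
      then show "s \<in> {s \<in> T. h s \<in> cover ` (U \<inter> ball x r)}" using \<xi>(2) by simp
    next
      fix s assume "s \<in> {s \<in> T. h s \<in> cover ` (U \<inter> ball x r)}"
      then obtain y where y: "s \<in> T" "y \<in> U" "y \<in> ball x r" "h s = cover y" by blast
      then have "\<xi> s = y" using uniq[OF \<xi>(1)] \<xi>(2) by metis
      then show "s \<in> T \<inter> \<xi> -` U" using y by simp
    qed
    moreover have "openin circle_top (cover ` (U \<inter> ball x r))"
      by (intro open_map_cover open_Int that open_ball)
    ultimately show ?thesis using h unfolding continuous_map_def by simp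
  qed
  then have "continuous_on T \<xi>" unfolding continuous_openin_preimage_eq by blast
  then show ?thesis using that \<xi> by blast
qed

text \<open>Nothing is assumed about the smoothness of \<open>h\<close>. It is lifted to a
  continuous \<open>\<xi>\<close> on the line, and on the image \<open>X\<close> the primitive
  \<open>P\<close> has the same derivative as \<open>\<sigma>\<close> composed with
  \<open>cover\<close>. With \<open>\<sigma> (h s) = s\<close> this gives
  \<open>P (\<xi> s) = s\<close>, which forces \<open>\<xi>\<close> to be a restriction of the
  holomorphic inverse of \<open>P\<close>.\<close>

lemma arclength_parametrization_analytic:
  assumes I: "parameter_space I" and an: "analytic_curve I \<gamma>" and par: "arclength_parametrization I \<gamma> J h"
  shows "analytic_curve (Some ` J) (\<lambda>p. \<gamma> (h (the p)))"
proof (rule analytic_curve_realI)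
  fix s0 assume s0: "s0 \<in> J"
  have J: "is_interval J" and h: "continuous_map (top_of_set J) circle_top h" and hJ: "h ` J = I"
    using par by (auto simp: arclength_parametrization_def)
  obtain N \<sigma> where N: "openin (top_of_set J) N" "s0 \<in> N"
    and len: "spherical_arclength (h ` N) \<gamma> \<sigma>" and \<sigma>: "\<And>s. s \<in> N \<Longrightarrow> \<sigma> (h s) = s"
    using par s0 unfolding arclength_parametrization_def by metis
  have "N \<subseteq> J" using N(1) openin_imp_subset by blast
  then have NI: "h ` N \<subseteq> I" using hJ by blast
  obtain x0 where x0: "cover x0 = h s0" using cover_surj by blast
  have "cover x0 \<in> I" using x0 s0 hJ by auto
  then obtain e f b where form: "holomorphic_form (\<lambda>y. \<gamma> (cover y)) {y. cover y \<in> I} x0 e f b"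
    using analytic_curve_cover_form[OF an] by blast
  define v where "v y = norm (deriv f (of_real y)) / (1 + (norm (f (of_real y)))\<^sup>2)" for y :: real
  obtain d P where d: "0 < d" "d \<le> e" and P_hol: "P holomorphic_on ball (of_real x0) d"
    and P_inj: "inj_on P (ball (of_real x0) d)" and P0: "P (of_real x0) = of_real s0"
    and P': "\<And>y. \<bar>y - x0\<bar> < d \<Longrightarrow> (P has_field_derivative of_real (v y)) (at (of_real y))"
    using speed_holomorphic_extension[OF form, of s0] unfolding v_def by metis
  \<comment> \<open>The bound \<open>d\<close> keeps the lift inside the disc of \<open>P\<close>,
    and pi / 2 makes \<open>cover\<close> injective on the ball.\<close>
  define r where "r = min d (pi / 2)"
  have "r > 0" using d by (simp add: r_def)
  obtain \<delta> where \<delta>: "\<delta> > 0" "J \<inter> ball s0 \<delta> \<subseteq> N" "h ` (J \<inter> ball s0 \<delta>) \<subseteq> cover ` ball x0 r"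
  proof -
    have "openin (top_of_set J) {s \<in> J. h s \<in> cover ` ball x0 r}"
      using h open_map_cover[OF open_ball] by (simp add: continuous_map_def)
    then have "openin (top_of_set J) (N \<inter> {s \<in> J. h s \<in> cover ` ball x0 r})"
      using N(1) by blast
    moreover have "s0 \<in> N \<inter> {s \<in> J. h s \<in> cover ` ball x0 r}"
      using N(2) s0 x0 \<open>r > 0\<close> by (auto intro!: image_eqI[of _ _ x0])
    ultimately obtain \<delta> where "\<delta> > 0" "ball s0 \<delta> \<inter> J \<subseteq> N \<inter> {s \<in> J. h s \<in> cover ` ball x0 r}"
      unfolding openin_contains_ball by blast
    then show ?thesis using that by blast
  qed
  define T where "T = J \<inter> ball s0 \<delta>"
  have "s0 \<in> T" using s0 \<delta>(1) by (simp add: T_def)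
  have "T \<subseteq> N" "T \<subseteq> J" using \<delta>(2) by (auto simp: T_def)
  have "is_interval T" unfolding T_def using J by (intro is_interval_Int is_interval_ball_real)
  have hT: "continuous_map (top_of_set T) circle_top h"
    using h \<open>T \<subseteq> J\<close> continuous_map_from_subtopology_mono by blast
  have "h ` T \<subseteq> cover ` ball x0 r" "r \<le> pi / 2" using \<delta>(3) by (simp_all add: T_def r_def)
  with hT obtain \<xi> where \<xi>: "continuous_on T \<xi>"
    "\<And>s. s \<in> T \<Longrightarrow> \<xi> s \<in> ball x0 r" "\<And>s. s \<in> T \<Longrightarrow> cover (\<xi> s) = h s"
    by (rule continuous_lift_through_cover) blast
  have \<xi>0: "\<xi> s0 = x0"
  proof (rule cover_eq_near)
    show "cover (\<xi> s0) = cover x0" using \<xi>(3)[OF \<open>s0 \<in> T\<close>] x0 by simp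
    have "\<bar>\<xi> s0 - x0\<bar> < pi / 2"
      using \<xi>(2)[OF \<open>s0 \<in> T\<close>] by (simp add: r_def dist_real_def abs_minus_commute)
    then show "\<bar>\<xi> s0 - x0\<bar> < pi" using pi_gt_zero by linarith
  qed
  define X where "X = \<xi> ` T"
  have "x0 \<in> X" using \<xi>0 \<open>s0 \<in> T\<close> unfolding X_def by force
  have Xd: "\<bar>x - x0\<bar> < d" if "x \<in> X" for x
    using that \<xi>(2) by (fastforce simp: X_def r_def dist_real_def)
  have "connected X" unfolding X_def
    using \<open>is_interval T\<close> \<xi>(1) connected_continuous_image is_interval_connected by blast
  then have "convex X" using is_interval_convex is_interval_connected_1 by blast
  have XN: "cover x \<in> h ` N" if "x \<in> X" for x using that \<xi>(3) \<open>T \<subseteq> N\<close> by (auto simp: X_def)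
  \<comment> \<open>A parameter space has two distinct points, so the interval \<open>J\<close> is
    nondegenerate and remains so after localisation. As \<open>\<sigma>\<close> inverts
    \<open>h\<close>, the image \<open>X\<close> is nondegenerate too, and all its points are limit
    points.\<close>
  have "\<exists>s1\<in>T. s1 \<noteq> s0"
  proof -
    obtain t where t: "t \<in> J" "t \<noteq> s0"
      using I hJ unfolding parameter_space_def by (metis imageE)
    have "connected J" using J is_interval_connected by blast
    then have "s0 islimpt J" using connected_imp_perfect s0 t by blast
    then show ?thesis using \<delta>(1) unfolding islimpt_approachable T_def
      by (metis Int_iff dist_commute mem_ball)
  qed
  then obtain s1 where "s1 \<in> T" "s1 \<noteq> s0" by blast
  then have "\<xi> s1 \<noteq> \<xi> s0" using \<sigma> \<xi>(3) \<open>s0 \<in> T\<close> \<open>T \<subseteq> N\<close> by (metis subsetD)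
  then have lim: "x islimpt X" if "x \<in> X" for x
    using \<open>connected X\<close> that connected_imp_perfect \<open>s1 \<in> T\<close> \<open>s0 \<in> T\<close> unfolding X_def
    by (metis image_eqI singletonD)
  have deriv: "((\<lambda>y. \<sigma> (cover y)) has_real_derivative v x) (at x within X)" if "x \<in> X" for x
  proof -
    have "holomorphic_form (\<lambda>y. \<gamma> (cover y)) {y. cover y \<in> I} x (e - \<bar>x - x0\<bar>) f b"
      by (rule holomorphic_form_recenter[OF form]) (use Xd[OF that] d in simp)
    then have "holomorphic_form (\<lambda>y. \<gamma> (cover y)) X x (e - \<bar>x - x0\<bar>) f b"
      by (rule holomorphic_form_subset) (use XN NI Xd[OF that] d(2) in auto)
    then have "spherical_speed (\<lambda>y. \<gamma> (cover y)) X x = v x"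
      unfolding v_def using lim[OF that] that
      by (intro spherical_speed_eq) (auto simp: trivial_limit_within)
    then show ?thesis
      using arclength_cover_derivative[OF an len NI XN that lim[OF that]] by simp
  qed
  \<comment> \<open>The difference has derivative zero within the convex set \<open>X\<close>,
    endpoints included; the constant is 0, since both functions equal \<open>s0\<close> at
    \<open>x0\<close>.\<close>
  have const: "\<exists>k. \<forall>x\<in>X. P (of_real x) - of_real (\<sigma> (cover x)) = k"
  proof -
    have "((\<lambda>x. P (of_real x) - of_real (\<sigma> (cover x))) has_vector_derivative 0) (at x within X)"
      if "x \<in> X" for x
    proof -
      have "((\<lambda>x. P (of_real x)) has_vector_derivative of_real (v x)) (at x within X)"
        by (rule has_vector_derivative_real_field) (rule P'[OF Xd[OF that]])
      moreover have "((\<lambda>x. complex_of_real (\<sigma> (cover x))) has_vector_derivative of_real (v x)) (at x within X)"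
        using deriv[OF that] by (rule has_vector_derivative_of_real)
      ultimately show ?thesis using has_vector_derivative_diff by fastforce
    qed
    from has_vector_derivative_zero_constant[OF \<open>convex X\<close> this] show ?thesis by blast
  qed
  then have P_\<sigma>: "P (of_real x) = of_real (\<sigma> (cover x))" if "x \<in> X" for x
  proof -
    have "P (of_real x0) - of_real (\<sigma> (cover x0)) = 0" using P0 x0 \<sigma>[OF N(2)] by simp
    then have "P (of_real x) - of_real (\<sigma> (cover x)) = 0"
      using const \<open>x0 \<in> X\<close> that by metis
    then show ?thesis by simp
  qed
  obtain Q where Q_hol: "Q holomorphic_on P ` ball (of_real x0) d"
    and QP: "\<And>z. z \<in> ball (of_real x0) d \<Longrightarrow> Q (P z) = z"
    using holomorphic_has_inverse[OF P_hol open_ball P_inj] by metis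
  have "open (P ` ball (of_real x0) d)" by (rule open_mapping_thm3[OF P_hol open_ball P_inj])
  moreover have "of_real s0 \<in> P ` ball (of_real x0) d"
    using P0 d(1) by (metis centre_in_ball imageI)
  ultimately obtain \<epsilon>0 where \<epsilon>0: "\<epsilon>0 > 0" "ball (of_real s0) \<epsilon>0 \<subseteq> P ` ball (of_real x0) d"
    using openE by blast
  \<comment> \<open>The bound by \<open>\<delta>\<close> keeps the arc-length values in
    \<open>T\<close>, where the lift is available.\<close>
  define \<epsilon> where "\<epsilon> = min \<epsilon>0 \<delta>"
  have \<epsilon>: "ball (complex_of_real s0) \<epsilon> \<subseteq> P ` ball (of_real x0) d" using \<epsilon>0(2) by (auto simp: \<epsilon>_def)
  have Q: "Q w \<in> ball (of_real x0) e \<and> P (Q w) = w" if "w \<in> ball (of_real s0) \<epsilon>" for w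
    using that \<epsilon> QP d(2) by fastforce
  have f: "f holomorphic_on ball (of_real x0) e" "inj_on f (ball (of_real x0) e)"
    using form by (auto simp: holomorphic_form_def)
  have "holomorphic_form (\<lambda>s. \<gamma> (h s)) J s0 \<epsilon> (f \<circ> Q) b"
    unfolding holomorphic_form_def
  proof (intro conjI ballI impI)
    show "\<epsilon> > 0" using \<epsilon>0(1) \<delta>(1) by (simp add: \<epsilon>_def)
    show "(f \<circ> Q) holomorphic_on ball (of_real s0) \<epsilon>"
      using holomorphic_on_compose_gen[OF holomorphic_on_subset[OF Q_hol \<epsilon>] f(1)] Q by blast
    show "inj_on (f \<circ> Q) (ball (of_real s0) \<epsilon>)"
      using Q f(2) by (intro inj_onI) (metis comp_apply inj_onD)
    fix s assume s: "s \<in> J" "\<bar>s - s0\<bar> < \<epsilon>"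
    then have "s \<in> T" by (simp add: T_def \<epsilon>_def dist_real_def abs_minus_commute)
    then have "\<xi> s \<in> X" by (simp add: X_def)
    have "P (of_real (\<xi> s)) = of_real s"
      using P_\<sigma>[OF \<open>\<xi> s \<in> X\<close>] \<xi>(3) \<sigma> \<open>s \<in> T\<close> \<open>T \<subseteq> N\<close> by (metis subsetD)
    moreover have "of_real (\<xi> s) \<in> ball (complex_of_real x0) d"
      using Xd[OF \<open>\<xi> s \<in> X\<close>] by (simp add: dist_real_def abs_minus_commute)
    ultimately have "Q (of_real s) = of_real (\<xi> s)" using QP by metis
    moreover have "\<gamma> (cover (\<xi> s)) = chart b (f (of_real (\<xi> s)))"
    proof -
      have "cover (\<xi> s) \<in> I" "\<bar>\<xi> s - x0\<bar> < e"
        using Xd[OF \<open>\<xi> s \<in> X\<close>] d(2) XN[OF \<open>\<xi> s \<in> X\<close>] NI by auto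
      then show ?thesis using form by (auto simp: holomorphic_form_def)
    qed
    ultimately show "\<gamma> (h s) = chart b ((f \<circ> Q) (of_real s))" using \<xi>(3)[OF \<open>s \<in> T\<close>] by simp
  qed
  then show "\<exists>e f b. holomorphic_form (\<lambda>s. \<gamma> (h s)) J s0 e f b" by blast
qed

subsection \<open>Existence of an arc-length parametrization\<close>

text \<open>If a point is missing from \<open>I\<close>, cutting the line at one of its lifts leaves
  an open interval of one period on which \<open>cover\<close> is injective and open; a separation
  of the lift would therefore separate \<open>I\<close>. The full circle offers no place to cut, so
  the entire line is taken and injectivity is given up.\<close>

lemma parameter_space_lift:
  assumes I: "parameter_space I"
  obtains B where "open B" "cover ` ({x. cover x \<in> I} \<inter> B) = I" "is_interval ({x. cover x \<in> I} \<inter> B)"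
    "if I = UNIV then B = UNIV else inj_on cover B"
proof (cases "I = UNIV")
  case True
  have "range cover = UNIV" using cover_surj unfolding surj_def by metis
  then show ?thesis using that[of UNIV] True by auto
next
  case False
  then obtain a where a: "cover a \<notin> I" using cover_surj by (metis UNIV_eq_I)
  define B where "B = {a<..<a + pi}"
  define K where "K = {x. cover x \<in> I} \<inter> B"
  have "open B" by (simp add: B_def)
  have inj: "inj_on cover B"
    by (intro inj_onI cover_eq_near) (auto simp: B_def)
  have img: "cover ` K = I"
  proof
    show "I \<subseteq> cover ` K"
    proof
      fix p assume "p \<in> I"
      obtain x where x: "cover x = p" using cover_surj by blast
      \<comment> \<open>Adding this multiple of the period moves \<open>x\<close> into [a, a + pi);
        the left end is then excluded because it does not map into \<open>I\<close>.\<close>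
      define k where "k = - \<lfloor>(x - a) / pi\<rfloor>"
      define y where "y = x + k * pi"
      have cy: "cover y = p" by (simp only: y_def cover_periodic x)
      have "real_of_int \<lfloor>(x - a) / pi\<rfloor> * pi \<le> x - a" "x - a < (real_of_int \<lfloor>(x - a) / pi\<rfloor> + 1) * pi"
        by (rule floor_divide_lower floor_divide_upper; simp)+
      then have "a \<le> y" "y < a + pi" by (simp_all add: y_def k_def algebra_simps)
      moreover have "y \<noteq> a" using cy \<open>p \<in> I\<close> a by blast
      ultimately have "y \<in> K" using cy \<open>p \<in> I\<close> by (simp add: K_def B_def)
      then show "p \<in> cover ` K" using cy by blast
    qed
  qed (auto simp: K_def)
  have "connected K"
  proof (rule connectedI)
    fix E1 E2 assume E: "open E1" "open E2" "E1 \<inter> K \<noteq> {}" "E2 \<inter> K \<noteq> {}" "E1 \<inter> E2 \<inter> K = {}" "K \<subseteq> E1 \<union> E2"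
    define F1 F2 where "F1 = cover ` (E1 \<inter> B)" and "F2 = cover ` (E2 \<inter> B)"
    have op: "openin circle_top F1" "openin circle_top F2"
      unfolding F1_def F2_def using E \<open>open B\<close> by (auto intro!: open_map_cover)
    have "I \<subseteq> F1 \<union> F2"
    proof
      fix p assume "p \<in> I"
      then obtain x where "x \<in> K" "p = cover x" using img by blast
      then show "p \<in> F1 \<union> F2" using E(6) unfolding F1_def F2_def K_def by blast
    qed
    moreover have "F1 \<inter> I \<noteq> {}" "F2 \<inter> I \<noteq> {}"
      using E(3,4) unfolding F1_def F2_def K_def by blast+
    moreover have "F1 \<inter> F2 \<inter> I = {}"
    proof (rule ccontr)
      assume "F1 \<inter> F2 \<inter> I \<noteq> {}"
      then obtain q where "q \<in> F1" "q \<in> F2" "q \<in> I" by blast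
      then obtain x y where xy: "x \<in> E1 \<inter> B" "y \<in> E2 \<inter> B" "cover x = q" "cover y = q"
        unfolding F1_def F2_def by (metis imageE)
      then have "x = y" using inj by (metis IntD2 inj_onD)
      then have "x \<in> E1 \<inter> E2 \<inter> K" using xy \<open>q \<in> I\<close> by (simp add: K_def)
      then show False using E(5) by blast
    qed
    moreover have "connectedin circle_top I" using I by (simp add: parameter_space_def)
    ultimately show False unfolding connectedin using op by meson
  qed
  then have "is_interval K" using is_interval_connected_1 by blast
  then show ?thesis using that[OF \<open>open B\<close>] img inj False unfolding K_def by simp
qed

section \<open>Primitives and mean values on real intervals\<close>

text \<open>\<open>K\<close> may be open, half-open or unbounded, whereas the fundamental theorem is
  applied on a compact interval. So \<open>{a..b}\<close> is chosen anew for each \<open>x\<close>,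
  always containing the base point \<open>c\<close>.\<close>

lemma is_interval_primitive:
  fixes v :: "real \<Rightarrow> real"
  assumes K: "is_interval K" and v: "continuous_on K v"
  obtains L where "\<And>x. x \<in> K \<Longrightarrow> (L has_real_derivative v x) (at x within K)"
proof (cases "K = {}")
  case True
  then show ?thesis using that by blast
next
  case False
  then obtain c where c: "c \<in> K" by blast
  have "((\<lambda>u. LBINT y=c..u. v y) has_real_derivative v x) (at x within K)" if x: "x \<in> K" for x
  proof -
    have min_max: "min x c \<in> K" "max x c \<in> K" using x c by (auto simp: min_def max_def)
    \<comment> \<open>\<open>a\<close> lies strictly to the left of \<open>x\<close> and
      \<open>c\<close> unless their minimum is already the left end of \<open>K\<close>, and
      \<open>b\<close> likewise on the right; thus \<open>{a..b}\<close> is a neighbourhood of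
      \<open>x\<close> relative to \<open>K\<close>.\<close>
    obtain a where a: "a \<in> K" "a \<le> min x c" "a = min x c \<longrightarrow> (\<forall>y\<in>K. a \<le> y)"
      using min_max(1) by (metis le_less linorder_not_le order_refl)
    obtain b where b: "b \<in> K" "max x c \<le> b" "b = max x c \<longrightarrow> (\<forall>y\<in>K. y \<le> b)"
      using min_max(2) by (metis le_less linorder_not_le order_refl)
    have ab: "{a..b} \<subseteq> K"
      using K a(1) b(1) unfolding is_interval_1 by (meson atLeastAtMost_iff subsetI)
    have "((\<lambda>u. LBINT y=c..u. v y) has_real_derivative v x) (at x within {a..b})"
      unfolding has_real_derivative_iff_has_vector_derivative
      by (rule interval_integral_FTC2) (use a b continuous_on_subset[OF v ab] in auto)
    moreover have "at x within K = at x within {a..b}"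
    proof (rule at_within_nhd)
      let ?S = "{if a = min x c then x - 1 else a<..<if b = max x c then x + 1 else b}"
      show "x \<in> ?S" using a(2) b(2) by auto
      show "K \<inter> ?S - {x} = {a..b} \<inter> ?S - {x}"
        using a(3) b(3) ab by (auto split: if_splits)
    qed simp
    ultimately show ?thesis by simp
  qed
  then show ?thesis using that by blast
qed

lemma has_real_derivative_mvt:
  assumes K: "is_interval K" and L: "\<And>x. x \<in> K \<Longrightarrow> (L has_real_derivative v x) (at x within K)"
    and xy: "x \<in> K" "y \<in> K" "x < y"
  shows "\<exists>z\<in>K. L y - L x = v z * (y - x)"
proof -
  have sub: "{x..y} \<subseteq> K"
    using K xy unfolding is_interval_1 by (meson atLeastAtMost_iff subsetI)
  have "\<exists>z\<in>{x<..<y}. L y - L x = (\<lambda>h. v z * h) (y - x)"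
  proof (rule mvt_simple[OF xy(3)])
    fix z assume "x \<le> z" "z \<le> y"
    then have "(L has_real_derivative v z) (at z within {x..y})"
      using sub by (intro DERIV_subset[OF L]) auto
    then show "(L has_derivative (\<lambda>h. v z * h)) (at z within {x..y})"
      by (simp add: has_field_derivative_def)
  qed
  then show ?thesis using sub by (auto simp: subset_iff)
qed

section \<open>Properties of the speed on the covering line\<close>

lemma spherical_speed_subset:
  assumes an: "analytic_curve I \<gamma>" and "X \<subseteq> Y" "Y \<subseteq> {y. cover y \<in> I}" "x \<in> X" "x islimpt X"
  shows "spherical_speed (\<lambda>y. \<gamma> (cover y)) X x = spherical_speed (\<lambda>y. \<gamma> (cover y)) Y x"
proof -
  obtain e f b where form: "holomorphic_form (\<lambda>y. \<gamma> (cover y)) {y. cover y \<in> I} x e f b"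
    using analytic_curve_cover_form[OF an, of x] assms by blast
  have e: "e > 0" using form by (simp add: holomorphic_form_def)
  have *: "spherical_speed (\<lambda>y. \<gamma> (cover y)) Z x = norm (deriv f (of_real x)) / (1 + (norm (f (of_real x)))\<^sup>2)"
    if "X \<subseteq> Z" "Z \<subseteq> Y" for Z
  proof (rule spherical_speed_eq)
    show "holomorphic_form (\<lambda>y. \<gamma> (cover y)) Z x e f b"
      by (rule holomorphic_form_subset[OF form]) (use e that assms in auto)
    have "x islimpt Z" using assms(5) that(1) islimpt_subset by blast
    then show "at x within Z \<noteq> bot" by (simp add: trivial_limit_within)
  qed (use that assms in auto)
  show ?thesis using *[of X] *[of Y] assms(2) by simp
qed

text \<open>One form describes the curve throughout a neighbourhood of \<open>x\<close>, so the
  speed is there a single continuous expression in f and f'. It is positive because an injective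
  holomorphic function has no critical points.\<close>

lemma spherical_speed_continuous_pos:
  assumes an: "analytic_curve I \<gamma>" and KI: "K \<subseteq> {y. cover y \<in> I}" and lim: "\<And>x. x \<in> K \<Longrightarrow> x islimpt K"
  shows "continuous_on K (spherical_speed (\<lambda>y. \<gamma> (cover y)) K)"
    and "\<And>x. x \<in> K \<Longrightarrow> spherical_speed (\<lambda>y. \<gamma> (cover y)) K x > 0"
proof -
  let ?v = "spherical_speed (\<lambda>y. \<gamma> (cover y)) K"
  have main: "continuous (at x within K) ?v \<and> ?v x > 0" if x: "x \<in> K" for x
  proof -
    obtain e f b where form0: "holomorphic_form (\<lambda>y. \<gamma> (cover y)) {y. cover y \<in> I} x e f b"
      using analytic_curve_cover_form[OF an, of x] KI x by blast
    have e: "e > 0" "f holomorphic_on ball (of_real x) e" using form0 by (auto simp: holomorphic_form_def)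
    have form: "holomorphic_form (\<lambda>y. \<gamma> (cover y)) K x e f b"
      by (rule holomorphic_form_subset[OF form0]) (use e KI in auto)
    define w where "w y = norm (deriv f (of_real y)) / (1 + (norm (f (of_real y)))\<^sup>2)" for y :: real
    have v: "?v y = w y" if "y \<in> K" "\<bar>y - x\<bar> < e" for y
      unfolding w_def
    proof (rule spherical_speed_eq)
      show "holomorphic_form (\<lambda>y. \<gamma> (cover y)) K y (e - \<bar>y - x\<bar>) f b"
        by (rule holomorphic_form_recenter[OF form that(2)])
      show "at y within K \<noteq> bot" using lim[OF that(1)] by (simp add: trivial_limit_within)
    qed (rule that(1))
    have nz: "1 + (norm (f (of_real x)))\<^sup>2 > 0" by (rule add_pos_nonneg) auto
    have "isCont f (of_real x)" "isCont (deriv f) (of_real x)"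
      using e holomorphic_deriv[OF e(2) open_ball]
      by (auto intro!: holomorphic_on_imp_continuous_on continuous_on_interior simp: interior_open)
    then have "isCont (\<lambda>y. f (of_real y)) x" "isCont (\<lambda>y. deriv f (of_real y)) x"
      by (auto intro!: isCont_o2[where f = of_real] isCont_of_real)
    then have "isCont w x" unfolding w_def using nz by (intro continuous_intros) auto
    then have "continuous (at x within K) w" by (rule continuous_at_imp_continuous_at_within)
    then have "continuous (at x within K) ?v"
      by (rule continuous_transform_within[OF _ e(1) x]) (simp add: v dist_real_def)
    moreover have "?v x > 0"
      using v[OF x] e(1) holomorphic_form_deriv(2)[OF form] nz by (simp add: w_def)
    ultimately show ?thesis by blast
  qed
  then show "continuous_on K ?v" by (simp add: continuous_on_eq_continuous_within)
  show "\<And>x. x \<in> K \<Longrightarrow> ?v x > 0" using main by blast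
qed

lemma surj_primitive_of_speed:
  assumes an: "analytic_curve UNIV \<gamma>"
    and L: "\<And>x. (L has_real_derivative spherical_speed (\<lambda>y. \<gamma> (cover y)) UNIV x) (at x)"
  shows "range L = UNIV"
proof -
  let ?v = "spherical_speed (\<lambda>y. \<gamma> (cover y)) UNIV"
  have lim: "x islimpt UNIV" for x :: real by (rule islimpt_UNIV)
  have cont: "continuous_on UNIV ?v" and pos: "\<And>x. ?v x > 0"
    using spherical_speed_continuous_pos[OF an, of UNIV] lim by auto
  \<comment> \<open>By \<open>spherical_speed_cover\<close> the speed depends on the point only
    through the chart coordinate of its image under \<open>cover\<close>.\<close>
  have periodic: "?v x = ?v y" if xy: "cover x = cover y" for x y
  proof -
    obtain c u where cu: "cover y = chart c u" by (metis chart_exhaust)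
    show ?thesis
      using spherical_speed_cover[OF an, of x c u UNIV UNIV] spherical_speed_cover[OF an, of y c u UNIV UNIV]
        lim cu xy by simp
  qed
  have "\<exists>z\<in>{0..pi}. \<forall>y\<in>{0..pi}. ?v z \<le> ?v y"
    by (rule continuous_attains_inf) (use continuous_on_subset[OF cont] in auto)
  then obtain z where z: "\<And>y. y \<in> {0..pi} \<Longrightarrow> ?v z \<le> ?v y" by blast
  define m where "m = ?v z"
  have "m > 0" using pos by (simp add: m_def)
  have m: "m \<le> ?v x" for x
  proof -
    define k where "k = - \<lfloor>x / pi\<rfloor>"
    define y where "y = x + k * pi"
    have "?v y = ?v x" by (rule periodic) (simp only: y_def cover_periodic)
    moreover have "real_of_int \<lfloor>x / pi\<rfloor> * pi \<le> x" "x < (real_of_int \<lfloor>x / pi\<rfloor> + 1) * pi"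
      by (rule floor_divide_lower floor_divide_upper; simp)+
    then have "y \<in> {0..pi}" by (simp add: y_def k_def algebra_simps)
    ultimately show ?thesis using z by (metis m_def)
  qed
  have growth: "m * (y - x) \<le> L y - L x" if "x < y" for x y
  proof -
    have "\<exists>z\<in>UNIV. L y - L x = ?v z * (y - x)"
      by (rule has_real_derivative_mvt[OF is_interval_univ]) (use L that in auto)
    then obtain z where "L y - L x = ?v z * (y - x)" by blast
    then show ?thesis using m[of z] that by (simp add: mult_right_mono)
  qed
  have "continuous_on UNIV L" by (rule DERIV_continuous_on) (rule L)
  then have "connected (range L)" by (rule connected_continuous_image) simp
  then have interval: "is_interval (range L)" by (simp add: is_interval_connected_1)
  have lower: "\<exists>x. L x \<le> t" for t
  proof -
    \<comment> \<open>At this distance from 0 the growth bound forces a change of at least |t - L 0|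
      + 1; the summand 1 keeps the point distinct from 0, as \<open>growth\<close> asks for a strict
      inequality.\<close>
    define x where "x = - (\<bar>t - L 0\<bar> + 1) / m"
    have "x < 0" using \<open>m > 0\<close> by (simp add: x_def divide_neg_pos)
    then have "m * (0 - x) \<le> L 0 - L x" by (rule growth)
    moreover have "m * (0 - x) = \<bar>t - L 0\<bar> + 1" using \<open>m > 0\<close> by (simp add: x_def)
    ultimately have "L x \<le> t" by linarith
    then show ?thesis by blast
  qed
  have upper: "\<exists>x. t \<le> L x" for t
  proof -
    define x where "x = (\<bar>t - L 0\<bar> + 1) / m"
    have "0 < x" using \<open>m > 0\<close> by (simp add: x_def)
    then have "m * (x - 0) \<le> L x - L 0" by (rule growth)
    moreover have "m * (x - 0) = \<bar>t - L 0\<bar> + 1" using \<open>m > 0\<close> by (simp add: x_def)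
    ultimately have "t \<le> L x" by linarith
    then show ?thesis by blast
  qed
  have "t \<in> range L" for t
  proof -
    obtain x y where "L x \<le> t" "t \<le> L y" using lower upper by blast
    then show ?thesis using interval unfolding is_interval_1 by blast
  qed
  then show ?thesis by blast
qed

section \<open>Arc-length from a primitive of the speed\<close>

text \<open>Near each point the coordinate has a smooth inverse branch \<open>\<rho>\<close>, along
  which \<open>\<sigma>\<close> becomes \<open>L\<close>. With radius pi / 4 two points of
  \<open>W\<close> are less than pi / 2 apart, which leaves another pi / 2 for \<open>\<rho>\<close>
  to move before distinct points of a fibre of \<open>cover\<close> could be confused.\<close>

lemma spherical_arclength_of_primitive:
  assumes an: "analytic_curve I \<gamma>" and KI: "K \<subseteq> {y. cover y \<in> I}" and lim: "\<And>x. x \<in> K \<Longrightarrow> x islimpt K"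
    and L: "\<And>x. x \<in> K \<Longrightarrow> (L has_real_derivative spherical_speed (\<lambda>y. \<gamma> (cover y)) K x) (at x within K)"
    and W: "open W" "W \<subseteq> ball a (pi / 4)"
    and \<sigma>: "\<And>x. x \<in> K \<inter> W \<Longrightarrow> \<sigma> (cover x) = L x"
  shows "spherical_arclength (cover ` (K \<inter> W)) \<gamma> \<sigma>"
proof -
  let ?A = "cover ` (K \<inter> W)" and ?v = "spherical_speed (\<lambda>y. \<gamma> (cover y)) K"
  have main: "((\<lambda>y. \<sigma> (chart c y)) has_real_derivative
      (if c then -1 else 1) * spherical_speed (\<lambda>y. \<gamma> (chart c y)) {y. chart c y \<in> ?A} u)
      (at u within {y. chart c y \<in> ?A})" if cuA: "chart c u \<in> ?A" for c u
  proof -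
    obtain x where x: "x \<in> K \<inter> W" "cover x = chart c u" using cuA by auto
    define s :: real where "s = (if c then -1 else 1)"
    \<comment> \<open>The shift \<open>x - lift c u\<close> is an integer multiple of pi and selects
      the branch through \<open>x\<close>.\<close>
    define \<rho> where "\<rho> y = lift c y + (x - lift c u)" for y
    have \<rho>u: "\<rho> u = x" by (simp add: \<rho>_def)
    obtain k :: int where k: "x = lift c u + k * pi"
      using x(2) unfolding cover_lift[of c u, symmetric] cover_eq_iff by blast
    have \<rho>: "cover (\<rho> y) = chart c y" for y
    proof -
      have "\<rho> y = lift c y + k * pi" using k by (simp add: \<rho>_def)
      then show ?thesis by (simp only: cover_periodic cover_lift)
    qed
    have \<rho>': "(\<rho> has_real_derivative s * inverse (1 + u\<^sup>2)) (at u within S)" for S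
      using DERIV_add[OF has_derivative_lift[of c u S] DERIV_const[of "x - lift c u"]]
      by (cases c) (simp_all add: \<rho>_def[abs_def] s_def)
    have "isCont \<rho> u" using \<rho>'[of UNIV] DERIV_isCont by blast
    then obtain d where d: "d > 0" "\<And>y. dist y u < d \<Longrightarrow> dist (\<rho> y) x < pi / 2"
      using pi_half_gt_zero unfolding continuous_at_eps_delta \<rho>u by metis
    define Y where "Y = {y. chart c y \<in> ?A} \<inter> ball u d"
    have \<rho>Y: "\<rho> y \<in> K \<inter> W" if "y \<in> Y" for y
    proof -
      have "chart c y \<in> ?A" using that by (simp add: Y_def)
      then obtain z where z: "z \<in> K \<inter> W" "chart c y = cover z" by blast
      have "\<bar>\<rho> y - x\<bar> < pi / 2" using d(2)[of y] that by (simp add: Y_def dist_real_def abs_minus_commute)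
      moreover have "z \<in> ball a (pi / 4)" "x \<in> ball a (pi / 4)" using z(1) x(1) W(2) by blast+
      then have "dist a x < pi / 4" "dist a z < pi / 4" by simp_all
      then have "\<bar>x - z\<bar> < pi / 2" using dist_triangle3[of x z a] unfolding dist_real_def by linarith
      ultimately have "\<bar>\<rho> y - z\<bar> < pi" using abs_triangle_ineq[of "\<rho> y - x" "x - z"] by simp
      then have "\<rho> y = z" using z(2) \<rho> by (intro cover_eq_near) auto
      then show ?thesis using z(1) by simp
    qed
    have "u \<in> Y" using cuA d(1) by (simp add: Y_def)
    have limW: "x islimpt K \<inter> W"
    proof -
      have "at x within K \<inter> W = at x within K"
        by (rule at_within_nhd[of x W]) (use x W in auto)
      then show ?thesis using lim[of x] x(1) by (metis IntD1 trivial_limit_within)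
    qed
    have speed: "?v x = spherical_speed (\<lambda>y. \<gamma> (chart c y)) {y. chart c y \<in> ?A} u * (1 + u\<^sup>2)"
    proof -
      have "spherical_speed (\<lambda>y. \<gamma> (cover y)) (K \<inter> W) x = ?v x"
        by (rule spherical_speed_subset[OF an]) (use x KI limW in auto)
      moreover have "spherical_speed (\<lambda>y. \<gamma> (cover y)) (K \<inter> W) x =
          spherical_speed (\<lambda>y. \<gamma> (chart c y)) {y. chart c y \<in> ?A} u * (1 + u\<^sup>2)"
        by (rule spherical_speed_cover[OF an x(2) limW x(1)]) (use KI in auto)
      ultimately show ?thesis by simp
    qed
    have "\<rho> ` Y \<subseteq> K" using \<rho>Y by blast
    then have "(L has_real_derivative ?v x) (at (\<rho> u) within \<rho> ` Y)"
      unfolding \<rho>u using L x(1) DERIV_subset by blast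
    then have "(L \<circ> \<rho> has_real_derivative ?v x * (s * inverse (1 + u\<^sup>2))) (at u within Y)"
      by (rule DERIV_image_chain) (rule \<rho>')
    \<comment> \<open>The factor 1 + u^2 between the speeds on the line and in the chart cancels
      against the derivative of the branch; the sign \<open>s\<close> stays, as the definition
      requires at infinity.\<close>
    moreover have "1 + u\<^sup>2 \<noteq> 0" using sum_power2_gt_zero_iff[of 1 u] by simp
    then have "q * (1 + u\<^sup>2) * (s * inverse (1 + u\<^sup>2)) = s * q" for q by simp
    ultimately have "(L \<circ> \<rho> has_real_derivative
        s * spherical_speed (\<lambda>y. \<gamma> (chart c y)) {y. chart c y \<in> ?A} u) (at u within Y)"
      unfolding speed by simp
    then have "((\<lambda>y. \<sigma> (chart c y)) has_real_derivative
        s * spherical_speed (\<lambda>y. \<gamma> (chart c y)) {y. chart c y \<in> ?A} u) (at u within Y)"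
    proof (rule has_field_derivative_transform_within[OF _ zero_less_one \<open>u \<in> Y\<close>])
      fix y assume "y \<in> Y"
      then show "(L \<circ> \<rho>) y = \<sigma> (chart c y)" using \<sigma>[OF \<rho>Y] \<rho> by simp
    qed
    moreover have "at u within Y = at u within {y. chart c y \<in> ?A}"
      by (rule at_within_nhd[of u "ball u d"]) (use d in \<open>auto simp: Y_def\<close>)
    ultimately show ?thesis by (simp add: s_def)
  qed
  show ?thesis
    unfolding spherical_arclength_def
  proof (intro conjI allI impI)
    fix t assume "Some t \<in> ?A"
    then show "((\<lambda>u. \<sigma> (Some u)) has_real_derivative
        spherical_speed (\<lambda>u. \<gamma> (Some u)) {u. Some u \<in> ?A} t) (at t within {u. Some u \<in> ?A})"
      using main[of False t] by simp
  next
    assume "None \<in> ?A"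
    then show "((\<lambda>u. \<sigma> (recip (Some u))) has_real_derivative
        - spherical_speed (\<lambda>u. \<gamma> (recip (Some u))) {u. recip (Some u) \<in> ?A} 0)
        (at 0 within {u. recip (Some u) \<in> ?A})"
      using main[of True 0] by (simp add: chart_def recip_def)
  qed
qed

text \<open>The primitive \<open>L\<close> is global and, the speed being positive, a homeomorphism
  onto \<open>J\<close>. The function \<open>\<sigma>\<close> must be built locally, because on the
  whole circle \<open>cover\<close> is not injective on \<open>K\<close>.\<close>

lemma arclength_parametrization_exists:
  assumes I: "parameter_space I" and an: "analytic_curve I \<gamma>"
  shows "\<exists>J h. arclength_parametrization I \<gamma> J h"
proof -
  obtain B where B: "open B" "cover ` ({x. cover x \<in> I} \<inter> B) = I" "is_interval ({x. cover x \<in> I} \<inter> B)"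
    "if I = UNIV then B = UNIV else inj_on cover B"
    using parameter_space_lift[OF I] by blast
  define K where "K = {x. cover x \<in> I} \<inter> B"
  have KI: "K \<subseteq> {y. cover y \<in> I}" and K: "is_interval K" and coverK: "cover ` K = I"
    using B by (auto simp: K_def)
  obtain p q where "p \<in> I" "q \<in> I" "p \<noteq> q" using I unfolding parameter_space_def by blast
  then have "K \<noteq> {x}" for x using coverK by auto
  then have lim: "x islimpt K" if "x \<in> K" for x
    using connected_imp_perfect[OF is_interval_connected[OF K] that] by blast
  define v where "v = spherical_speed (\<lambda>y. \<gamma> (cover y)) K"
  have v: "continuous_on K v" "\<And>x. x \<in> K \<Longrightarrow> v x > 0"
    unfolding v_def using spherical_speed_continuous_pos[OF an KI lim] by blast+
  obtain L where L: "\<And>x. x \<in> K \<Longrightarrow> (L has_real_derivative v x) (at x within K)"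
    using is_interval_primitive[OF K v(1)] by blast
  have mono: "L x < L y" if "x \<in> K" "y \<in> K" "x < y" for x y
  proof -
    have "\<exists>z\<in>K. L y - L x = v z * (y - x)" by (rule has_real_derivative_mvt[OF K L that])
    then obtain z where "z \<in> K" "L y - L x = v z * (y - x)" by blast
    then show ?thesis using v(2)[of z] that(3) by (metis diff_gt_0_iff_gt mult_pos_pos)
  qed
  then have injL: "inj_on L K" by (metis inj_onI less_irrefl linorder_neqE_linordered_idom)
  have contL: "continuous_on K L" using L DERIV_continuous_on by blast
  define J where "J = L ` K"
  obtain g where g: "homeomorphism K J L g"
    using homeomorphism_into_1d[OF is_interval_path_connected[OF K] contL _ injL] J_def by blast
  have gJ: "g ` J = K" and contg: "continuous_on J g" and gL: "\<And>x. x \<in> K \<Longrightarrow> g (L x) = x"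
    and Lg: "\<And>s. s \<in> J \<Longrightarrow> L (g s) = s"
    using g by (auto simp: homeomorphism_def)
  define h where "h = cover \<circ> g"
  have "arclength_parametrization I \<gamma> J h"
    unfolding arclength_parametrization_def
  proof (intro conjI ballI)
    show "is_interval J"
      unfolding J_def using K contL connected_continuous_image is_interval_connected_1 by blast
    have "continuous_map (top_of_set J) euclidean g" using contg by simp
    then show "continuous_map (top_of_set J) circle_top h"
      unfolding h_def using continuous_map_cover continuous_map_compose by blast
    show "h ` J = I" unfolding h_def image_comp[symmetric] gJ by (rule coverK)
    show "if I = UNIV then J = UNIV else inj_on h J"
    proof (cases "I = UNIV")
      case True
      then have "K = UNIV" using B(4) by (simp add: K_def)
      then have "range L = UNIV"
        using surj_primitive_of_speed[of \<gamma> L] an True L unfolding v_def by simp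
      then show ?thesis using True \<open>K = UNIV\<close> by (simp add: J_def)
    next
      case False
      then have "inj_on cover B" using B(4) by simp
      then have "inj_on cover K" by (rule inj_on_subset) (simp add: K_def)
      moreover have "inj_on g J" using Lg by (metis inj_onI)
      ultimately have "inj_on h J" unfolding h_def using gJ comp_inj_on by metis
      then show ?thesis using False by simp
    qed
    fix s0 assume "s0 \<in> J"
    \<comment> \<open>Intersecting with \<open>B\<close> makes the image of
      \<open>K \<inter> W\<close> the trace on \<open>I\<close> of an open set; pi / 4 is the radius
      for which a primitive yields an arc-length.\<close>
    define W where "W = ball (g s0) (pi / 4) \<inter> B"
    define N where "N = L ` (K \<inter> W)"
    have "open W" using B(1) by (auto simp: W_def)
    have "g s0 \<in> K" using gJ \<open>s0 \<in> J\<close> by blast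
    then have "g s0 \<in> K \<inter> W" by (auto simp: W_def K_def)
    have injW: "inj_on cover (K \<inter> W)"
      using inj_on_cover_ball[of "pi / 4" "g s0"] by (rule inj_on_subset) (auto simp: W_def)
    define \<sigma> where "\<sigma> p = L (inv_into (K \<inter> W) cover p)" for p
    have \<sigma>: "\<sigma> (cover x) = L x" if "x \<in> K \<inter> W" for x
      using inv_into_f_f[OF injW that] by (simp add: \<sigma>_def)
    have hN: "h ` N = cover ` (K \<inter> W)"
    proof -
      have "h (L x) = cover x" if "x \<in> K \<inter> W" for x using that gL by (simp add: h_def)
      then show ?thesis unfolding N_def by (force simp: image_iff)
    qed
    have "openin (top_of_set J) N"
    proof -
      have "N = J \<inter> g -` W" unfolding N_def J_def using gL by auto
      then show ?thesis using continuous_openin_preimage_gen[OF contg \<open>open W\<close>] by simp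
    qed
    moreover have "s0 \<in> N"
      using \<open>g s0 \<in> K \<inter> W\<close> Lg[OF \<open>s0 \<in> J\<close>] unfolding N_def by (metis imageI)
    moreover have "openin (subtopology circle_top I) (h ` N)"
    proof -
      have "h ` N = cover ` W \<inter> I" unfolding hN by (auto simp: K_def W_def)
      then show ?thesis using open_map_cover[OF \<open>open W\<close>] openin_subtopology_Int by metis
    qed
    moreover have "spherical_arclength (h ` N) \<gamma> \<sigma>"
      unfolding hN using L \<sigma> \<open>open W\<close> unfolding v_def
      by (intro spherical_arclength_of_primitive[OF an KI lim, where L = L and a = "g s0"])
         (auto simp: W_def)
    moreover have "\<forall>s\<in>N. \<sigma> (h s) = s"
      using \<sigma> gL by (auto simp: N_def h_def)
    ultimately show "\<exists>N \<sigma>. openin (top_of_set J) N \<and> s0 \<in> N \<and> openin (subtopology circle_top I) (h ` N) \<and>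
        spherical_arclength (h ` N) \<gamma> \<sigma> \<and> (\<forall>s\<in>N. \<sigma> (h s) = s)"
      by blast
  qed
  then show ?thesis by blast
qed

text \<open>The existence half guarantees that the universal half is not vacuous; the latter covers
  every choice of the additive constant.\<close>

theorem theorem4p2:
  fixes I :: "real option set" and \<gamma> :: "real option \<Rightarrow> complex option"
  assumes "parameter_space I"
    and "analytic_curve I \<gamma>"
  shows "(\<exists>J h. arclength_parametrization I \<gamma> J h) \<and>
    (\<forall>J h. arclength_parametrization I \<gamma> J h \<longrightarrow>
       analytic_curve (Some ` J) (\<lambda>s. \<gamma> (h (the s))))"
  using arclength_parametrization_exists[OF assms] arclength_parametrization_analytic[OF assms] by blast

end
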